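(* Let $\Omega\subseteq\mathbb{H}^n$ be an open set and let $u\in PSH(\Omega)\cap C^2(\Omega)$. Then $\triangle u$ is a closed strongly positive $2$-form on $\Omega$; that is, $d_0\triangle u=d_1\triangle u=0$ (in the sense of distributions) and $\triangle u(q)$ is a strongly positive element of $\wedge^2\mathbb{C}^{2n}$ for every $q\in\Omega$.
   Context: Points of $\mathbb{H}^n\cong\mathbb{R}^{4n}$ are $q=(q_0,\dots,q_{n-1})$, $q_l=x_{4l}+\mathbf{i}x_{4l+1}+\mathbf{j}x_{4l+2}+\mathbf{k}x_{4l+3}$. Define (here $\mathbf{i}$ is the imaginary unit of $\mathbb{C}$), for $l=0,\dots,n-1$: $\nabla_{(2l)0}=\partial_{x_{4l}}+\mathbf{i}\partial_{x_{4l+1}}$, $\nabla_{(2l)1}=-\partial_{x_{4l+2}}-\mathbf{i}\partial_{x_{4l+3}}$, $\nabla_{(2l+1)0}=\partial_{x_{4l+2}}-\mathbf{i}\partial_{x_{4l+3}}$, $\nabla_{(2l+1)1}=\partial_{x_{4l}}-\mathbf{i}\partial_{x_{4l+1}}$. Let $\{\omega^0,\dots,\omega^{2n-1}\}$ be a fixed basis of $\mathbb{C}^{2n}$, $\omega^I=\omega^{i_1}\wedge\dots\wedge\omega^{i_p}$. For $F=\sum_I f_I\omega^I$ put $d_\alpha F=\sum_{k,I}\nabla_{k\alpha}f_I\,\omega^k\wedge\omega^I$ ($\alpha=0,1$) and $\triangle F=d_0d_1F$. An upper semicontinuous function $u:\Omega\to[-\infty,\infty)$ is plurisubharmonic ($u\in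 PSH(\Omega)$) if its restriction to (the intersection with $\Omega$ of) each right quaternionic line $\{a+b\lambda:\lambda\in\mathbb{H}\}$ is subharmonic. Strong positivity: for a quaternion $a=a^0+\mathbf{i}a^1+\mathbf{j}a^2+\mathbf{k}a^3$ put $\tau(a)=\begin{pmatrix}a^0-\mathbf{i}a^1&-a^2+\mathbf{i}a^3\\ a^2+\mathbf{i}a^3&a^0+\mathbf{i}a^1\end{pmatrix}$, and for a quaternionic $l\times m$ matrix let $\tau$ denote the complex $2l\times 2m$ matrix obtained by applying $\tau$ to each entry. A right $\mathbb{H}$-linear map $\eta:\mathbb{H}^n\to\mathbb{H}$ is a $1\times n$ quaternionic matrix; put $\eta^*\widetilde\omega^p=\sum_{j=0}^{2n-1}\tau(\eta)_{pj}\omega^j$, $p=0,1$. An element of $\wedge^{2k}\mathbb{C}^{2n}$ is elementary strongly positive if it has the form $\eta_1^*\widetilde\omega^0\wedge\eta_1^*\widetilde\omega^1\wedge\dots\wedge\eta_k^*\widetilde\omega^0\wedge\eta_k^*\widetilde\omega^1$ with $\eta_1,\dots,\eta_k:\mathbb{H}^n\to\mathbb{H}$ linearly independent right $\mathbb{H}$-linear maps; it is strongly positive if it is a finite linear combination with non-negative coefficients of elementary strongly positive elements. *)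

theory Defs
  imports "HOL-Analysis.Analysis"
begin

section \<open>Functions of class \<open>C\<^sup>k\<close>, subharmonic functions\<close>

abbreviation partial :: "'a::real_normed_vector \<Rightarrow> ('a \<Rightarrow> 'b::real_normed_vector) \<Rightarrow> 'a \<Rightarrow> 'b" where
  "partial v f x \<equiv> frechet_derivative f (at x) v"

primrec Ck_on :: "nat \<Rightarrow> ('a::euclidean_space \<Rightarrow> 'b::real_normed_vector) \<Rightarrow> 'a set \<Rightarrow> bool" where
  "Ck_on 0 f S \<longleftrightarrow> continuous_on S f"
| "Ck_on (Suc k) f S \<longleftrightarrow>
     (\<forall>x\<in>S. f differentiable at x) \<and> (\<forall>b\<in>Basis. Ck_on k (partial b f) S)"

definition usc_on :: "'a::topological_space set \<Rightarrow> ('a \<Rightarrow> ereal) \<Rightarrow> bool" where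
  "usc_on S f \<longleftrightarrow> (\<forall>c. openin (top_of_set S) {x \<in> S. f x < c})"

definition harmonic_on :: "'a::euclidean_space set \<Rightarrow> ('a \<Rightarrow> real) \<Rightarrow> bool" where
  "harmonic_on S h \<longleftrightarrow> Ck_on 2 h S \<and> (\<forall>x\<in>S. (\<Sum>b\<in>Basis. partial b (partial b h) x) = 0)"

text \<open>Subharmonicity by comparison with harmonic functions on compact sets; the value
  \<open>-\<infinity>\<close> is admitted everywhere, so the function constantly \<open>-\<infinity>\<close> is subharmonic.\<close>

definition subharmonic_on :: "'a::euclidean_space set \<Rightarrow> ('a \<Rightarrow> ereal) \<Rightarrow> bool" where
  "subharmonic_on S f \<longleftrightarrow>
     (\<forall>x\<in>S. f x < \<infinity>) \<and> usc_on S f \<and>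
     (\<forall>K h. compact K \<and> K \<subseteq> S \<and> continuous_on K h \<and> harmonic_on (interior K) h \<and>
            (\<forall>x\<in>frontier K. f x \<le> ereal (h x)) \<longrightarrow>
            (\<forall>x\<in>K. f x \<le> ereal (h x)))"

section \<open>Quaternions and plurisubharmonic functions\<close>

text \<open>The numeral type \<open>4\<close> has the elements \<open>0, 1, 2, 3\<close>, so the components of a quaternion are
  \<open>a$0, a$1, a$2, a$3\<close>. Multiplication is \<open>qmult\<close>: the library's \<open>*\<close> on \<open>real^4\<close> is
  componentwise.\<close>

type_synonym quat = "real^4"
type_synonym 'n hvec = "quat^'n"

definition qmult :: "quat \<Rightarrow> quat \<Rightarrow> quat" where
  "qmult a b = (\<chi> i.
     if i = 0 then a$0 * b$0 - a$1 * b$1 - a$2 * b$2 - a$3 * b$3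
     else if i = 1 then a$0 * b$1 + a$1 * b$0 + a$2 * b$3 - a$3 * b$2
     else if i = 2 then a$0 * b$2 - a$1 * b$3 + a$2 * b$0 + a$3 * b$1
     else a$0 * b$3 + a$1 * b$2 - a$2 * b$1 + a$3 * b$0)"

definition right_scale :: "('n::finite) hvec \<Rightarrow> quat \<Rightarrow> 'n hvec" where
  "right_scale b \<mu> = (\<chi> l. qmult (b$l) \<mu>)"

text \<open>A right quaternionic line is identified with \<open>\<real>\<^sup>4\<close> through the parametrisation
  \<open>\<mu> \<mapsto> a + b\<mu>\<close>; for \<open>b \<noteq> 0\<close> this is a similarity onto the line, so subharmonicity does not
  depend on the choice of \<open>a\<close> and \<open>b\<close>.\<close>

definition psh_on :: "('n::finite) hvec set \<Rightarrow> ('n hvec \<Rightarrow> ereal) \<Rightarrow> bool" where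
  "psh_on \<Omega> u \<longleftrightarrow>
     (\<forall>q\<in>\<Omega>. u q < \<infinity>) \<and> usc_on \<Omega> u \<and>
     (\<forall>a b. b \<noteq> 0 \<longrightarrow>
        subharmonic_on {\<mu>. a + right_scale b \<mu> \<in> \<Omega>} (\<lambda>\<mu>. u (a + right_scale b \<mu>)))"

section \<open>The exterior algebra of \<open>\<complex>\<^sup>2\<^sup>n\<close>\<close>

text \<open>The index set \<open>{0, \<dots>, 2n-1}\<close> is \<open>'n \<times> 2\<close>, where \<open>(l, s)\<close> with \<open>s = 0, 1\<close> stands for
  \<open>2l + s\<close>; its order is lexicographic. (The library order on pairs is componentwise.)
  An element \<open>\<Sum>\<^sub>I A\<^sub>I \<omega>\<^sup>I\<close> of the exterior algebra is given by its coefficients with respect to the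
  basis \<open>\<omega>\<^sup>I\<close>, where \<open>I\<close> ranges over all sets of indices and \<open>\<omega>\<^sup>I\<close> is the wedge product of
  the \<open>\<omega>\<^sup>i\<close>, \<open>i \<in> I\<close>, in increasing order.\<close>

type_synonym 'n idx = "'n \<times> 2"
type_synonym 'n ext = "complex ^ ('n idx set)"

definition idx_less :: "'n::linorder idx \<Rightarrow> 'n idx \<Rightarrow> bool" where
  "idx_less i j \<longleftrightarrow> fst i < fst j \<or> (fst i = fst j \<and> snd i < snd j)"

definition omega_set :: "('n::finite) idx set \<Rightarrow> 'n ext" where
  "omega_set I = axis I 1"

definition omega :: "('n::finite) idx \<Rightarrow> 'n ext" where
  "omega i = omega_set {i}"

text \<open>For disjoint \<open>I\<close> and \<open>J\<close>, \<open>\<omega>\<^sup>I \<and> \<omega>\<^sup>J\<close> is \<open>\<omega>\<close> indexed by \<open>I \<union> J\<close>, with the sign of the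
  permutation that sorts the concatenation of \<open>I\<close> and \<open>J\<close>.\<close>

definition wedge_sign :: "('n::{finite,linorder}) idx set \<Rightarrow> 'n idx set \<Rightarrow> complex" where
  "wedge_sign I J = (-1) ^ card {(i, j). i \<in> I \<and> j \<in> J \<and> idx_less j i}"

definition wedge :: "('n::{finite,linorder}) ext \<Rightarrow> 'n ext \<Rightarrow> 'n ext" (infixr "\<and>\<^sub>e" 70) where
  "A \<and>\<^sub>e B = (\<chi> K. \<Sum>I\<in>Pow K. wedge_sign I (K - I) * A$I * B$(K - I))"

section \<open>The operators \<open>d\<^sub>0\<close>, \<open>d\<^sub>1\<close> and \<open>\<triangle>\<close>\<close>

text \<open>\<open>partial_x l j\<close> is the derivative with respect to the real coordinate \<open>x\<close> number
  \<open>4l + j\<close>.\<close>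

definition partial_x :: "'n::finite \<Rightarrow> 4 \<Rightarrow> ('n hvec \<Rightarrow> complex) \<Rightarrow> 'n hvec \<Rightarrow> complex" where
  "partial_x l j f q = partial (axis l (axis j 1)) f q"

definition nabla :: "('n::finite) idx \<Rightarrow> 2 \<Rightarrow> ('n hvec \<Rightarrow> complex) \<Rightarrow> 'n hvec \<Rightarrow> complex" where
  "nabla k \<alpha> f q = (let l = fst k in
     if snd k = 0 then
       (if \<alpha> = 0 then partial_x l 0 f q + \<i> * partial_x l 1 f q
        else - partial_x l 2 f q - \<i> * partial_x l 3 f q)
     else
       (if \<alpha> = 0 then partial_x l 2 f q - \<i> * partial_x l 3 f q
        else partial_x l 0 f q - \<i> * partial_x l 1 f q))"

definition d_op :: "2 \<Rightarrow> (('n::{finite,linorder}) hvec \<Rightarrow> 'n ext) \<Rightarrow> 'n hvec \<Rightarrow> 'n ext" where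
  "d_op \<alpha> F q =
     (\<Sum>k\<in>UNIV. \<Sum>I\<in>UNIV. nabla k \<alpha> (\<lambda>x. F x $ I) q *s (omega k \<and>\<^sub>e omega_set I))"

definition laplace_op :: "(('n::{finite,linorder}) hvec \<Rightarrow> 'n ext) \<Rightarrow> 'n hvec \<Rightarrow> 'n ext" where
  "laplace_op F = d_op 0 (d_op 1 F)"

definition zero_form :: "(('n::finite) hvec \<Rightarrow> real) \<Rightarrow> 'n hvec \<Rightarrow> 'n ext" where
  "zero_form u q = complex_of_real (u q) *s omega_set {}"

definition test_function :: "'a::euclidean_space set \<Rightarrow> ('a \<Rightarrow> complex) \<Rightarrow> bool" where
  "test_function \<Omega> \<phi> \<longleftrightarrow> (\<forall>k. Ck_on k \<phi> UNIV) \<and>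
     compact (closure {x. \<phi> x \<noteq> 0}) \<and> closure {x. \<phi> x \<noteq> 0} \<subseteq> \<Omega>"

definition dist_nabla ::
  "('n::finite) hvec set \<Rightarrow> 'n idx \<Rightarrow> 2 \<Rightarrow> ('n hvec \<Rightarrow> complex) \<Rightarrow> ('n hvec \<Rightarrow> complex) \<Rightarrow> complex" where
  "dist_nabla \<Omega> k \<alpha> f \<phi> = - set_lebesgue_integral lborel \<Omega> (\<lambda>q. f q * nabla k \<alpha> \<phi> q)"

definition dist_d_op ::
  "('n::{finite,linorder}) hvec set \<Rightarrow> 2 \<Rightarrow> ('n hvec \<Rightarrow> 'n ext) \<Rightarrow> ('n hvec \<Rightarrow> complex) \<Rightarrow> 'n ext" where
  "dist_d_op \<Omega> \<alpha> F \<phi> =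
     (\<Sum>k\<in>UNIV. \<Sum>I\<in>UNIV. dist_nabla \<Omega> k \<alpha> (\<lambda>x. F x $ I) \<phi> *s (omega k \<and>\<^sub>e omega_set I))"

text \<open>Local integrability is part of the notion: it makes the coefficients of \<open>F\<close>
  distributions on \<open>\<Omega>\<close>, and excludes that the integrals vanish by convention.\<close>

definition dist_d_closed ::
  "('n::{finite,linorder}) hvec set \<Rightarrow> 2 \<Rightarrow> ('n hvec \<Rightarrow> 'n ext) \<Rightarrow> bool" where
  "dist_d_closed \<Omega> \<alpha> F \<longleftrightarrow>
     (\<forall>I K. compact K \<and> K \<subseteq> \<Omega> \<longrightarrow> set_integrable lborel K (\<lambda>q. F q $ I)) \<and>
     (\<forall>\<phi>. test_function \<Omega> \<phi> \<longrightarrow> dist_d_op \<Omega> \<alpha> F \<phi> = 0)"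

section \<open>Strong positivity\<close>

definition tau :: "quat \<Rightarrow> complex^2^2" where
  "tau a = (\<chi> p s.
     if p = 0 then (if s = 0 then Complex (a$0) (- a$1) else Complex (- a$2) (a$3))
     else (if s = 0 then Complex (a$2) (a$3) else Complex (a$0) (a$1)))"

text \<open>A right \<open>\<bbbH>\<close>-linear map \<open>\<eta>\<close> from \<open>\<bbbH>\<^sup>n\<close> to \<open>\<bbbH>\<close> is represented by its \<open>1 \<times> n\<close> matrix, so that
  \<open>\<eta>(q) = \<Sum>\<^sub>l \<eta>\<^sub>l q\<^sub>l\<close>. The entry of \<open>\<tau>(\<eta>)\<close> in row \<open>p\<close> and column \<open>(l, s)\<close> is
  \<open>\<tau>(\<eta>\<^sub>l)\<close> at \<open>p, s\<close>.\<close>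

definition pullback :: "('n::finite) hvec \<Rightarrow> 2 \<Rightarrow> 'n ext" where
  "pullback \<eta> p = (\<Sum>j\<in>UNIV. tau (\<eta> $ fst j) $ p $ snd j *s omega j)"

text \<open>The right linear maps form a left \<open>\<bbbH>\<close>-vector space, with \<open>(c\<eta>)(q) = c(\<eta>(q))\<close>.\<close>

definition lin_indep :: "nat \<Rightarrow> (nat \<Rightarrow> ('n::finite) hvec) \<Rightarrow> bool" where
  "lin_indep k \<eta> \<longleftrightarrow>
     (\<forall>c. (\<forall>l. (\<Sum>i<k. qmult (c i) (\<eta> i $ l)) = 0) \<longrightarrow> (\<forall>i<k. c i = 0))"

definition elementary_strongly_positive :: "nat \<Rightarrow> ('n::{finite,linorder}) ext set" where
  "elementary_strongly_positive k =
     {foldr (\<lambda>i A. pullback (\<eta> i) 0 \<and>\<^sub>e pullback (\<eta> i) 1 \<and>\<^sub>e A) [0..<k] (omega_set {}) | \<eta>.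
        lin_indep k \<eta>}"

text \<open>\<open>strongly_positive k\<close> is the set of strongly positive elements of degree \<open>2k\<close>.\<close>

definition strongly_positive :: "nat \<Rightarrow> ('n::{finite,linorder}) ext set" where
  "strongly_positive k =
     {\<Sum>v\<in>S. c v *\<^sub>R v | S c.
        finite S \<and> S \<subseteq> elementary_strongly_positive k \<and> (\<forall>v\<in>S. 0 \<le> c v)}"

end

theory Submission
  imports Defs
begin

text \<open>
  Both claims rest on the expansion
  \<open>\<triangle>u = \<Sum>\<^sub>k \<Sum>\<^sub>k\<^sub>' \<nabla>\<^sub>k\<^sub>0 \<nabla>\<^sub>k\<^sub>'\<^sub>1 u \<cdot> \<omega>\<^sup>k \<and> \<omega>\<^sup>k\<^sup>'\<close> (\<open>laplace_op_eq_two_form\<close>).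

  Closedness. Pairing \<open>d\<^sub>\<alpha> \<triangle>u\<close> with a test function \<open>\<phi>\<close> and moving all derivatives onto \<open>\<phi>\<close>
  (\<open>nabla_by_parts\<close>) leaves the coefficients \<open>\<integral> u \<cdot> \<nabla>\<^sub>j\<^sub>1 \<nabla>\<^sub>i\<^sub>0 \<nabla>\<^sub>k\<^sub>\<alpha> \<phi>\<close> of
  \<open>\<omega>\<^sup>k \<and> \<omega>\<^sup>i \<and> \<omega>\<^sup>j\<close>. The operators commute on smooth functions (\<open>nabla_commute\<close>), so these
  coefficients are symmetric in \<open>k, i\<close> if \<open>\<alpha> = 0\<close> and in \<open>k, j\<close> if \<open>\<alpha> = 1\<close>, whereas the
  wedge product is antisymmetric (\<open>omega_anticommute\<close>). The sum therefore equals its own negative.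

  Strong positivity. Let \<open>H\<close> be the Hessian of \<open>u\<close> at \<open>q\<close> and
  \<open>B(b, c) = \<Sum>\<^sub>e H(be, ce)\<close>, where \<open>e\<close> runs over \<open>1, i, j, k\<close>. Then \<open>B(b, b)\<close> is the Laplacian at
  \<open>0\<close> of \<open>\<mu> \<mapsto> u(q + b\<mu>)\<close>, which is non-negative: otherwise the second order Taylor polynomial of
  this function, made harmonic by subtracting its trace part and shifted slightly, would dominate
  it on a small sphere and stay below it at the centre (\<open>subharmonic_laplacian_nonneg\<close>). Moreover
  \<open>B\<close> is symmetric and invariant under right multiplication of both arguments by a unit, that is,
  the real part of a quaternionic Hermitian form. The key observation is that the antisymmetrised
  coefficients \<open>\<nabla>\<^sub>k\<^sub>0 \<nabla>\<^sub>k\<^sub>'\<^sub>1 u - \<nabla>\<^sub>k\<^sub>'\<^sub>0 \<nabla>\<^sub>k\<^sub>1 u\<close> depend on \<open>H\<close> only through \<open>B\<close>,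
  and linearly (\<open>laplace_op_eq_herm_form\<close>). The same linear map sends the square
  \<open>B(b, c) = \<langle>\<eta>b, \<eta>c\<rangle>\<close> of a right linear map \<open>\<eta>\<close> to \<open>\<eta>\<^sup>*\<omega>\<^sup>0 \<and> \<eta>\<^sup>*\<omega>\<^sup>1\<close>
  (\<open>herm_form_elementary\<close>), so it remains to write \<open>B\<close> as a sum of squares. This is done by
  completing squares one coordinate at a time (\<open>q_psd_split_square\<close>, \<open>herm_form_strongly_positive\<close>).
\<close>

section \<open>Wedge products of basis covectors\<close>

lemma wedge_nth: "(A \<and>\<^sub>e B) $ K = (\<Sum>I\<in>Pow K. wedge_sign I (K - I) * A$I * B$(K - I))"
  by (simp add: wedge_def)

lemma wedge_add_left: "(A + B) \<and>\<^sub>e C = (A \<and>\<^sub>e C) + (B \<and>\<^sub>e C)"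
  by (simp add: vec_eq_iff wedge_nth algebra_simps sum.distrib)

lemma wedge_add_right: "A \<and>\<^sub>e (B + C) = (A \<and>\<^sub>e B) + (A \<and>\<^sub>e C)"
  by (simp add: vec_eq_iff wedge_nth algebra_simps sum.distrib)

lemma wedge_scale_left: "(c *s A) \<and>\<^sub>e B = c *s (A \<and>\<^sub>e B)"
  by (simp add: vec_eq_iff wedge_nth algebra_simps sum_distrib_left)

lemma wedge_scale_right: "A \<and>\<^sub>e (c *s B) = c *s (A \<and>\<^sub>e B)"
  by (simp add: vec_eq_iff wedge_nth algebra_simps sum_distrib_left)

lemma wedge_minus_right: "A \<and>\<^sub>e (- B) = - (A \<and>\<^sub>e B)"
  by (simp add: vec_eq_iff wedge_nth sum_negf)

lemma wedge_zero_left: "0 \<and>\<^sub>e A = 0"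
  by (simp add: vec_eq_iff wedge_nth)

lemma wedge_zero_right: "A \<and>\<^sub>e 0 = 0"
  by (simp add: vec_eq_iff wedge_nth)

lemma wedge_sum_left: "(\<Sum>i\<in>S. f i) \<and>\<^sub>e A = (\<Sum>i\<in>S. f i \<and>\<^sub>e A)"
  by (induction S rule: infinite_finite_induct) (auto simp: wedge_zero_left wedge_add_left)

lemma wedge_sum_right: "A \<and>\<^sub>e (\<Sum>i\<in>S. f i) = (\<Sum>i\<in>S. A \<and>\<^sub>e f i)"
  by (induction S rule: infinite_finite_induct) (auto simp: wedge_zero_right wedge_add_right)

lemma ext_expand: "(A :: ('n::finite) ext) = (\<Sum>I\<in>UNIV. A $ I *s omega_set I)"
  by (simp add: vec_eq_iff omega_set_def axis_def if_distrib sum.delta cong: if_cong)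

lemma wedge_omega_set:
  "omega_set I \<and>\<^sub>e omega_set J = (if I \<inter> J = {} then wedge_sign I J *s omega_set (I \<union> J) else 0)"
proof (rule vec_eq_iff[THEN iffD2], rule allI)
  fix K
  have "(omega_set I \<and>\<^sub>e omega_set J) $ K =
      (\<Sum>L\<in>Pow K. if L = I then (if K - I = J then wedge_sign I J else 0) else 0)"
    unfolding wedge_nth by (rule sum.cong) (auto simp: omega_set_def axis_def)
  also have "\<dots> = (if I \<subseteq> K \<and> K - I = J then wedge_sign I J else 0)"
    by (subst sum.delta) auto
  also have "\<dots> = (if I \<inter> J = {} then wedge_sign I J *s omega_set (I \<union> J) else 0) $ K"
    by (auto simp: omega_set_def axis_def)
  finally show "(omega_set I \<and>\<^sub>e omega_set J) $ K =
    (if I \<inter> J = {} then wedge_sign I J *s omega_set (I \<union> J) else 0) $ K" .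
qed

lemma wedge_unit_right: "A \<and>\<^sub>e omega_set {} = A"
proof -
  have "omega_set I \<and>\<^sub>e omega_set {} = omega_set I" for I :: "'a idx set"
    by (simp add: wedge_omega_set wedge_sign_def)
  then show ?thesis
    by (subst (1 2) ext_expand[of A]) (simp add: wedge_sum_left wedge_scale_left)
qed

text \<open>
  The sign of \<open>\<omega>\<^sup>k \<and> \<omega>\<^sup>J\<close> counts the elements of \<open>J\<close> below \<open>k\<close>, so a new element of \<open>J\<close>
  contributes one factor.
\<close>
lemma wedge_sign_insert:
  assumes "j \<notin> I"
  shows "wedge_sign {k} (insert j I) = (if idx_less j k then -1 else 1) * wedge_sign {k} I"
proof -
  have eq: "{(i, j'). i \<in> {k} \<and> j' \<in> J \<and> idx_less j' i} = Pair k ` {i \<in> J. idx_less i k}" for J :: "'a idx set"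
    by auto
  have card: "card {(i, j'). i \<in> {k} \<and> j' \<in> J \<and> idx_less j' i} = card {i \<in> J. idx_less i k}" for J :: "'a idx set"
    unfolding eq by (rule card_image) (auto simp: inj_on_def)
  have "{i \<in> insert j I. idx_less i k} =
      (if idx_less j k then insert j {i \<in> I. idx_less i k} else {i \<in> I. idx_less i k})"
    by auto
  then show ?thesis
    using assms unfolding wedge_sign_def card by simp
qed

lemma idx_less_linear: "j \<noteq> k \<Longrightarrow> idx_less k j \<longleftrightarrow> \<not> idx_less j k"
  by (cases j; cases k) (auto simp: idx_less_def)

text \<open>
  Of two distinct indices exactly one is below the other, so exactly one of the two orders picks
  up an additional sign from \<open>wedge_sign_insert\<close>.
\<close>
lemma omega_anticommute: "omega j \<and>\<^sub>e (omega k \<and>\<^sub>e A) = - (omega k \<and>\<^sub>e (omega j \<and>\<^sub>e A))"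
proof -
  have basis: "omega j \<and>\<^sub>e (omega k \<and>\<^sub>e omega_set I) = - (omega k \<and>\<^sub>e (omega j \<and>\<^sub>e omega_set I))" for I
  proof (cases "j = k \<or> j \<in> I \<or> k \<in> I")
    case True
    then show ?thesis
      by (auto simp: omega_def wedge_omega_set wedge_scale_right wedge_zero_right)
  next
    case False
    then have "omega j \<and>\<^sub>e (omega k \<and>\<^sub>e omega_set I) =
        (wedge_sign {k} I * wedge_sign {j} (insert k I)) *s omega_set (insert j (insert k I))"
      "omega k \<and>\<^sub>e (omega j \<and>\<^sub>e omega_set I) =
        (wedge_sign {j} I * wedge_sign {k} (insert j I)) *s omega_set (insert j (insert k I))"
      by (auto simp: omega_def wedge_omega_set wedge_scale_right insert_commute)
    then show ?thesis
      using False idx_less_linear[of j k] by (auto simp: wedge_sign_insert)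
  qed
  show ?thesis
    by (subst (1 2) ext_expand[of A])
      (simp add: wedge_sum_right wedge_scale_right basis sum_negf)
qed

lemma omega_anticommute2: "omega j \<and>\<^sub>e omega k = - (omega k \<and>\<^sub>e omega j)"
  using omega_anticommute[of j k "omega_set {}"] by (simp add: wedge_unit_right)

text \<open>
  Coefficients with the same antisymmetric part give the same form; the iterated operators yield
  coefficients that are not antisymmetric.
\<close>
definition two_form :: "(('n::{finite,linorder}) idx \<Rightarrow> 'n idx \<Rightarrow> complex) \<Rightarrow> 'n ext" where
  "two_form c = (\<Sum>k\<in>UNIV. \<Sum>k'\<in>UNIV. c k k' *s (omega k \<and>\<^sub>e omega k'))"

lemma two_form_swap: "two_form (\<lambda>k k'. c k' k) = - two_form c"
proof -
  have "two_form (\<lambda>k k'. c k' k) = (\<Sum>k\<in>UNIV. \<Sum>k'\<in>UNIV. c k k' *s (omega k' \<and>\<^sub>e omega k))"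
    unfolding two_form_def by (rule sum.swap)
  also have "\<dots> = (\<Sum>k\<in>UNIV. \<Sum>k'\<in>UNIV. - (c k k' *s (omega k \<and>\<^sub>e omega k')))"
    by (intro sum.cong refl) (subst omega_anticommute2, simp)
  finally show ?thesis by (simp add: two_form_def sum_negf)
qed

lemma two_form_add: "two_form (\<lambda>k k'. c k k' + c' k k') = two_form c + two_form c'"
  by (simp add: two_form_def sum.distrib vec.scale_left_distrib)

lemma pullback_wedge:
  "pullback \<eta> 0 \<and>\<^sub>e pullback \<eta> 1 =
    two_form (\<lambda>k k'. tau (\<eta> $ fst k) $ 0 $ snd k * tau (\<eta> $ fst k') $ 1 $ snd k')"
  unfolding pullback_def two_form_def
  by (simp add: wedge_sum_left) (simp add: wedge_sum_right wedge_scale_left wedge_scale_right mult.commute)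

section \<open>Quaternionic units\<close>

lemma numeral_4_zero: "(4::4) = 0" by simp

lemma sum_UNIV_4: "sum f (UNIV :: 4 set) = f 0 + f 1 + f 2 + f 3"
  using sum_4[of f] by (simp add: numeral_4_zero add_ac)

lemma all_UNIV_4: "(\<forall>i::4. P i) \<longleftrightarrow> P 0 \<and> P 1 \<and> P 2 \<and> P 3"
  using forall_4[of P] by (auto simp: numeral_4_zero)

lemma index_2_cases: "(s::2) = 0 \<or> s = 1"
  using exhaust_2[of s] by auto

abbreviation qunit :: "4 \<Rightarrow> quat" where "qunit i \<equiv> axis i 1"

abbreviation coord :: "'n::finite \<Rightarrow> 4 \<Rightarrow> 'n hvec" where
  "coord l j \<equiv> axis l (qunit j)"

lemma qmult_nth:
  "qmult a b $ 0 = a$0 * b$0 - a$1 * b$1 - a$2 * b$2 - a$3 * b$3"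
  "qmult a b $ 1 = a$0 * b$1 + a$1 * b$0 + a$2 * b$3 - a$3 * b$2"
  "qmult a b $ 2 = a$0 * b$2 - a$1 * b$3 + a$2 * b$0 + a$3 * b$1"
  "qmult a b $ 3 = a$0 * b$3 + a$1 * b$2 - a$2 * b$1 + a$3 * b$0"
  by (simp_all add: qmult_def)

lemma quat_eq_iff: "(a::quat) = b \<longleftrightarrow> a$0 = b$0 \<and> a$1 = b$1 \<and> a$2 = b$2 \<and> a$3 = b$3"
  by (simp add: vec_eq_iff all_UNIV_4)

lemma hvec_eq_iff: "(x :: 'n::finite hvec) = y \<longleftrightarrow> (\<forall>l. x $ l = y $ l)"
  by (rule vec_eq_iff)

lemma qunit_nth: "qunit i $ j = (if j = i then 1 else 0)"
  by (simp add: axis_def)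

lemma qmult_assoc: "qmult (qmult a b) c = qmult a (qmult b c)"
  by (simp add: quat_eq_iff qmult_nth algebra_simps)

text \<open>
  The multiplication table; it reduces all later identities over the four units to finite checks.
\<close>
lemma qmult_units:
  "qmult (qunit 0) a = a" "qmult a (qunit 0) = a"
  "qmult (qunit 1) (qunit 1) = - qunit 0" "qmult (qunit 1) (qunit 2) = qunit 3" "qmult (qunit 1) (qunit 3) = - qunit 2"
  "qmult (qunit 2) (qunit 1) = - qunit 3" "qmult (qunit 2) (qunit 2) = - qunit 0" "qmult (qunit 2) (qunit 3) = qunit 1"
  "qmult (qunit 3) (qunit 1) = qunit 2" "qmult (qunit 3) (qunit 2) = - qunit 1" "qmult (qunit 3) (qunit 3) = - qunit 0"
  by (simp_all add: quat_eq_iff qmult_nth axis_def)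

lemma right_scale_assoc: "right_scale (right_scale b p) q = right_scale b (qmult p q)"
  by (simp add: right_scale_def hvec_eq_iff qmult_assoc)

lemma qmult_minus: "qmult a (- b) = - qmult a b" "qmult (- a) b = - qmult a b"
  by (simp_all add: quat_eq_iff qmult_nth)

lemma qmult_zero: "qmult a 0 = 0" "qmult 0 b = 0"
  by (simp_all add: quat_eq_iff qmult_nth)

lemma right_scale_minus: "right_scale b (- p) = - right_scale b p"
  by (simp add: right_scale_def hvec_eq_iff qmult_minus)

lemma right_scale_one: "right_scale b (qunit 0) = b"
  by (simp add: right_scale_def hvec_eq_iff qmult_units)

lemma right_scale_axis: "right_scale (axis l a) p = axis l (qmult a p)"
  by (auto simp: right_scale_def hvec_eq_iff axis_def qmult_zero)

lemma axis_minus: "axis l (- a) = - axis l (a :: 'a::real_vector)"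
  by (auto simp: vec_eq_iff axis_def)

lemma bounded_linear_right_scale: "bounded_linear (right_scale b)"
proof -
  have "linear (right_scale b)"
    by (rule linearI) (auto simp: right_scale_def hvec_eq_iff quat_eq_iff qmult_nth algebra_simps)
  then show ?thesis by (rule linear_conv_bounded_linear[THEN iffD1])
qed

lemma linear_right_scale_left: "linear (\<lambda>b. right_scale b p)"
  by (rule linearI) (auto simp: right_scale_def hvec_eq_iff quat_eq_iff qmult_nth algebra_simps)

section \<open>Quaternionic Hermitian forms and strong positivity\<close>

text \<open>
  For the Hessian \<open>H\<close> of \<open>u\<close> at \<open>q\<close>, the value at \<open>(b, b)\<close> is the Laplacian at \<open>0\<close> of
  \<open>\<mu> \<mapsto> u(q + b\<mu>)\<close>, and \<open>q_trace H\<close> is the real part of the quaternionic Hermitian Hessian of \<open>u\<close>.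
\<close>
definition q_trace :: "('n::finite hvec \<Rightarrow> 'n hvec \<Rightarrow> real) \<Rightarrow> 'n hvec \<Rightarrow> 'n hvec \<Rightarrow> real" where
  "q_trace H b c = (\<Sum>i\<in>UNIV. H (right_scale b (qunit i)) (right_scale c (qunit i)))"

text \<open>
  These are the real parts of positive semidefinite quaternionic Hermitian forms: such a form is
  determined by its real part, and its sesquilinearity corresponds to the invariance of the real part
  under the units.
\<close>
definition q_psd :: "('n::finite hvec \<Rightarrow> 'n hvec \<Rightarrow> real) \<Rightarrow> bool" where
  "q_psd B \<longleftrightarrow> bilinear B \<and> (\<forall>b c. B b c = B c b) \<and> (\<forall>b. 0 \<le> B b b) \<and>
     (\<forall>j b c. B (right_scale b (qunit j)) (right_scale c (qunit j)) = B b c)"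

lemma bilinear_minus:
  assumes "bilinear B" shows "B (- x) y = - B x y" "B x (- y) = - B x y"
  using bilinear_lneg[OF assms] bilinear_rneg[OF assms] by auto

text \<open>
  The trace is invariant because right multiplication by a unit permutes the four units up to
  sign, and the signs cancel in a bilinear form.
\<close>
lemma q_psd_q_trace:
  assumes H: "bilinear H" and sym: "\<And>b c. H b c = H c b" and pos: "\<And>b. 0 \<le> q_trace H b b"
  shows "q_psd (q_trace H)"
proof -
  have "linear (\<lambda>c. q_trace H b c)" for b
    unfolding q_trace_def using H
    by (intro linear_compose_sum ballI linear_compose[OF linear_right_scale_left, unfolded o_def])
      (auto simp: bilinear_def)
  moreover have "linear (\<lambda>b. q_trace H b c)" for c
    unfolding q_trace_def using H
    by (intro linear_compose_sum ballI linear_compose[OF linear_right_scale_left, unfolded o_def])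
      (auto simp: bilinear_def)
  ultimately have "bilinear (q_trace H)"
    by (simp add: bilinear_def)
  moreover have "q_trace H b c = q_trace H c b" for b c
    by (simp add: q_trace_def sym)
  moreover have "\<forall>j. q_trace H (right_scale b (qunit j)) (right_scale c (qunit j)) = q_trace H b c" for b c
    by (simp add: all_UNIV_4 q_trace_def sum_UNIV_4 right_scale_assoc qmult_units right_scale_minus bilinear_minus[OF H])
  ultimately show ?thesis
    using pos by (auto simp: q_psd_def)
qed

text \<open>
  If \<open>h\<^sub>j\<close> denotes the value of \<open>B\<close> at the coordinate vector \<open>l\<close> and the coordinate vector \<open>m\<close>
  times the unit \<open>j\<close>, the block of indices \<open>(l, s), (m, s')\<close> has the rows
  \<open>-h\<^sub>2 - ih\<^sub>3, h\<^sub>0 - ih\<^sub>1\<close> and \<open>-h\<^sub>0 - ih\<^sub>1, -h\<^sub>2 + ih\<^sub>3\<close>. This is the antisymmetric complex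
  matrix of a Hermitian form: both \<open>\<triangle>u\<close> and the elementary strongly positive elements have
  coefficients of this shape.
\<close>
definition herm_coeff :: "('n::finite hvec \<Rightarrow> 'n hvec \<Rightarrow> real) \<Rightarrow> 'n idx \<Rightarrow> 'n idx \<Rightarrow> complex" where
  "herm_coeff B k k' = (let b = (\<lambda>j. B (coord (fst k) 0) (coord (fst k') j)) in
     if snd k = 0 then (if snd k' = 0 then Complex (- b 2) (- b 3) else Complex (b 0) (- b 1))
     else (if snd k' = 0 then Complex (- b 0) (- b 1) else Complex (- b 2) (b 3)))"

text \<open>
  Every pair of indices is counted in both orders, whence the factor \<open>1/2\<close>.
\<close>
definition herm_form :: "('n::{finite,linorder} hvec \<Rightarrow> 'n hvec \<Rightarrow> real) \<Rightarrow> 'n ext" where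
  "herm_form B = (1/2) *s two_form (herm_coeff B)"

lemma two_form_eq_herm_form:
  assumes "\<And>k k'. c k k' - c k' k = herm_coeff B k k'"
  shows "two_form c = herm_form B"
proof -
  have "two_form (\<lambda>k k'. c k k' - c k' k) = two_form c - two_form (\<lambda>k k'. c k' k)"
    by (simp add: two_form_def sum_subtractf vec.scale_left_diff_distrib)
  then show ?thesis
    unfolding two_form_swap[of c] herm_form_def by (simp add: vec_eq_iff assms)
qed

lemma herm_form_add: "herm_form (\<lambda>b c. B b c + B' b c) = herm_form B + herm_form B'"
proof -
  have "herm_coeff (\<lambda>b c. B b c + B' b c) = (\<lambda>k k'. herm_coeff B k k' + herm_coeff B' k k')"
    by (auto simp: herm_coeff_def Let_def complex_eq_iff intro!: ext)
  then show ?thesis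
    by (simp add: herm_form_def two_form_add vec.scale_right_distrib)
qed

text \<open>
  The right linear map with matrix \<open>\<eta>\<close>.
\<close>
definition q_apply :: "('n::finite) hvec \<Rightarrow> 'n hvec \<Rightarrow> quat" where
  "q_apply \<eta> x = (\<Sum>l\<in>UNIV. qmult (\<eta> $ l) (x $ l))"

lemma q_apply_axis: "q_apply \<eta> (axis l a) = qmult (\<eta> $ l) a"
proof -
  have "q_apply \<eta> (axis l a) = (\<Sum>m\<in>UNIV. if m = l then qmult (\<eta> $ m) a else 0)"
    unfolding q_apply_def by (rule sum.cong) (auto simp: axis_def qmult_zero)
  then show ?thesis by simp
qed

lemma inner_quat: "(a::quat) \<bullet> b = a$0 * b$0 + a$1 * b$1 + a$2 * b$2 + a$3 * b$3"
  by (simp add: inner_vec_def sum_UNIV_4)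

text \<open>
  The antisymmetrised products of entries of \<open>\<tau>(\<eta>\<^sub>l)\<close> and \<open>\<tau>(\<eta>\<^sub>m)\<close> have real
  and imaginary parts that are, up to sign, components of \<open>\<eta>\<^sub>l\<^sup>*\<eta>\<^sub>m\<close> (the conjugate of the first
  times the second). So are the values of the form on coordinate vectors.
\<close>
lemma herm_form_elementary:
  "herm_form (\<lambda>b c. q_apply \<eta> b \<bullet> q_apply \<eta> c) = pullback \<eta> 0 \<and>\<^sub>e pullback \<eta> 1"
  unfolding pullback_wedge
proof (rule two_form_eq_herm_form[symmetric])
  fix k k' :: "'a idx"
  show "tau (\<eta> $ fst k) $ 0 $ snd k * tau (\<eta> $ fst k') $ 1 $ snd k' -
        tau (\<eta> $ fst k') $ 0 $ snd k' * tau (\<eta> $ fst k) $ 1 $ snd k =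
        herm_coeff (\<lambda>b c. q_apply \<eta> b \<bullet> q_apply \<eta> c) k k'"
    using index_2_cases[of "snd k"] index_2_cases[of "snd k'"]
    by (auto simp: herm_coeff_def Let_def tau_def q_apply_axis inner_quat qmult_nth qunit_nth
        complex_eq_iff algebra_simps)
qed

lemma qmult_eq_0: "qmult c a = 0 \<Longrightarrow> a \<noteq> 0 \<Longrightarrow> c = 0"
proof -
  assume z: "qmult c a = 0" and a: "a \<noteq> 0"
  have "(qmult c a \<bullet> qmult c a) = (c \<bullet> c) * (a \<bullet> a)"
    by (simp add: inner_quat qmult_nth algebra_simps)
  then show ?thesis using z a by simp
qed

lemma pullback_wedge_elementary:
  assumes "\<eta> \<noteq> 0"
  shows "pullback \<eta> 0 \<and>\<^sub>e pullback \<eta> 1 \<in> elementary_strongly_positive 1"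
proof -
  obtain l where "\<eta> $ l \<noteq> 0" using assms by (auto simp: hvec_eq_iff)
  then have "lin_indep 1 (\<lambda>_. \<eta>)"
    by (auto simp: lin_indep_def dest: qmult_eq_0)
  then show ?thesis
    unfolding elementary_strongly_positive_def
    by (intro CollectI exI[of _ "\<lambda>_. \<eta>"]) (simp add: wedge_unit_right)
qed

lemma strongly_positive_zero: "0 \<in> strongly_positive k"
  unfolding strongly_positive_def by (intro CollectI exI[of _ "{}"]) auto

text \<open>
  Strongly positive elements are given by sums over a set of distinct elementary ones, so adding
  one that already occurs means raising its coefficient.
\<close>
lemma strongly_positive_add_elementary:
  assumes "A \<in> strongly_positive k" and v: "v \<in> elementary_strongly_positive k"
  shows "A + v \<in> strongly_positive k"
proof -
  obtain S c where S: "finite S" "S \<subseteq> elementary_strongly_positive k" "\<forall>v\<in>S. 0 \<le> c v"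
    and A: "A = (\<Sum>v\<in>S. c v *\<^sub>R v)"
    using assms(1) by (auto simp: strongly_positive_def)
  define c' where "c' w = (if w \<in> S then c w else 0) + (if w = v then 1 else 0)" for w
  have "(\<Sum>w\<in>insert v S. c' w *\<^sub>R w) =
      (\<Sum>w\<in>insert v S. (if w \<in> S then c w *\<^sub>R w else 0)) + (\<Sum>w\<in>insert v S. if w = v then w else 0)"
    unfolding sum.distrib[symmetric] by (rule sum.cong) (auto simp: c'_def algebra_simps)
  also have "(\<Sum>w\<in>insert v S. (if w \<in> S then c w *\<^sub>R w else 0)) = A"
    unfolding A by (rule sum.mono_neutral_cong_right) (use S in auto)
  also have "(\<Sum>w\<in>insert v S. if w = v then w else 0) = v"
    using S by simp
  finally show ?thesis
    unfolding strongly_positive_def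
    by (intro CollectI exI[of _ "insert v S"] exI[of _ c']) (use S v in \<open>auto simp: c'_def\<close>)
qed

text \<open>
  Otherwise \<open>B\<close> would be negative at \<open>y + tx\<close> for a suitable \<open>t\<close>, since its value there is affine in
  \<open>t\<close> with slope \<open>2B(x, y)\<close>.
\<close>
lemma psd_null_vector:
  assumes B: "bilinear B" and sym: "\<And>b c. B b c = B c b" and pos: "\<And>b. 0 \<le> B b b" and null: "B x x = 0"
  shows "B x y = (0::real)"
proof (rule ccontr)
  assume ne: "B x y \<noteq> 0"
  define t where "t = - (B y y + 1) / (2 * B x y)"
  have "B (y + t *\<^sub>R x) (y + t *\<^sub>R x) = B y y + 2 * t * B x y"
    using sym[of y x] null
    by (simp add: bilinear_ladd[OF B] bilinear_radd[OF B] bilinear_lmul[OF B] bilinear_rmul[OF B])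
  also have "\<dots> = -1" using ne by (simp add: t_def field_simps)
  finally show False using pos[of "y + t *\<^sub>R x"] by simp
qed

text \<open>
  Right multiplication by an imaginary unit is an isometry with square \<open>-1\<close>, hence skew.
\<close>
lemma q_psd_adjoint:
  assumes "q_psd B"
  shows "B x (right_scale y (qunit j)) = (if j = 0 then 1 else -1) * B (right_scale x (qunit j)) y"
proof -
  have B: "bilinear B" using assms by (simp add: q_psd_def)
  have "B x (right_scale y (qunit j)) =
      B (right_scale x (qunit j)) (right_scale (right_scale y (qunit j)) (qunit j))"
    using assms by (simp add: q_psd_def)
  moreover have "\<forall>j. right_scale (right_scale y (qunit j)) (qunit j) = (if j = 0 then y else - y)"
    by (simp add: all_UNIV_4 right_scale_assoc qmult_units right_scale_minus right_scale_one)
  ultimately show ?thesis by (simp add: bilinear_minus[OF B])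
qed

lemma coord_right_scale: "coord l j = right_scale (coord l 0) (qunit j)"
  by (simp add: right_scale_axis qmult_units)

lemma linear_q_apply: "linear (q_apply \<eta>)"
  by (rule linearI)
    (auto simp: q_apply_def quat_eq_iff qmult_nth algebra_simps sum.distrib sum_subtractf sum_distrib_left)

lemma q_apply_right_scale: "q_apply \<eta> (right_scale b p) = qmult (q_apply \<eta> b) p"
  by (simp add: q_apply_def right_scale_def quat_eq_iff qmult_nth algebra_simps
      sum.distrib sum_subtractf sum_distrib_left)

text \<open>
  One step of completing squares. For a coordinate vector \<open>v\<close> with \<open>N = B(v, v) > 0\<close>, the map
  \<open>\<eta>(x) = N\<^sup>-\<^sup>1\<^sup>/\<^sup>2 \<Sum>\<^sub>f B(vf, x) f\<close>, with \<open>f\<close> ranging over the four units, is right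
  linear. The vectors \<open>vf\<close> are pairwise orthogonal for \<open>B\<close>, so Bessel's inequality says that
  subtracting \<open>|\<eta>(x)|\<^sup>2\<close> leaves a positive semidefinite form. The new form vanishes at \<open>v\<close>.
\<close>
lemma q_psd_split_square:
  fixes B :: "'n::{finite,linorder} hvec \<Rightarrow> 'n hvec \<Rightarrow> real"
  assumes q: "q_psd B" and ne: "B (coord l 0) (coord l 0) \<noteq> 0"
  obtains \<eta> where "\<eta> \<noteq> 0" "q_psd (\<lambda>b c. B b c - q_apply \<eta> b \<bullet> q_apply \<eta> c)"
    "B (coord l 0) (coord l 0) = q_apply \<eta> (coord l 0) \<bullet> q_apply \<eta> (coord l 0)"
proof -
  have B: "bilinear B" and sym: "\<And>b c. B b c = B c b" and pos: "\<And>b. 0 \<le> B b b"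
    and inv: "\<And>j b c. B (right_scale b (qunit j)) (right_scale c (qunit j)) = B b c"
    using q by (auto simp: q_psd_def)
  define N where "N = B (coord l 0) (coord l 0)"
  have N: "0 < N" using pos[of "coord l 0"] ne by (simp add: N_def)
  define w :: "4 \<Rightarrow> 'n hvec" where "w j = coord l j" for j
  have adj: "B (w f) (coord m j) = (if j = 0 then 1 else -1) * B (axis l (qmult (qunit f) (qunit j))) (coord m 0)"
    for f m j
    unfolding w_def by (subst coord_right_scale[of m j], subst q_psd_adjoint[OF q]) (simp add: right_scale_axis)
  \<comment> \<open>skewness gives \<open>B (w 0) (w j) = - B (w j) (w 0)\<close>, and symmetry makes both sides zero\<close>
  have half: "B (w 1) (w 0) = 0 \<and> B (w 2) (w 0) = 0 \<and> B (w 3) (w 0) = 0"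
  proof -
    have "B (w 0) (w j) = - B (w j) (w 0)" if "j \<noteq> 0" for j
      using adj[of 0 l j] that by (simp add: qmult_units w_def)
    from this[of 1] this[of 2] this[of 3] show ?thesis
      using sym[of "w 0"] by simp
  qed
  have ortho: "\<forall>f g. B (w f) (w g) = (if f = g then N else 0)"
    using half adj[of _ l 1] adj[of _ l 2] adj[of _ l 3]
    by (simp add: all_UNIV_4 w_def qmult_units axis_minus bilinear_minus[OF B] N_def)
  define \<eta> :: "'n hvec" where "\<eta> = (\<chi> m. \<chi> f. B (w f) (coord m 0) / sqrt N)"
  have app: "q_apply \<eta> x $ f = B (w f) x / sqrt N" for x f
  proof -
    have l1: "linear (\<lambda>x. q_apply \<eta> x $ f)"
      using linear_q_apply[of \<eta>] by (auto simp: linear_iff)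
    have l2: "linear (\<lambda>x. B (w f) x / sqrt N)"
      using B by (auto simp: bilinear_def linear_iff add_divide_distrib)
    have "\<forall>f j. q_apply \<eta> (coord m j) $ f = B (w f) (coord m j) / sqrt N" for m
      unfolding adj
      by (simp add: all_UNIV_4 q_apply_axis qmult_nth qunit_nth \<eta>_def qmult_units axis_minus
          bilinear_minus[OF B] w_def)
    then have "(\<lambda>x. q_apply \<eta> x $ f) = (\<lambda>x. B (w f) x / sqrt N)"
      by (intro linear_eq_stdbasis[OF l1 l2]) (auto simp: Basis_vec_def)
    then show ?thesis by meson
  qed
  have sq: "q_apply \<eta> x \<bullet> q_apply \<eta> x = (\<Sum>f\<in>UNIV. (B (w f) x)\<^sup>2 / N)" for x
    using N by (simp add: inner_vec_def app power2_eq_square)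
  have bessel: "0 \<le> B x x - q_apply \<eta> x \<bullet> q_apply \<eta> x" for x
  proof -
    define a where "a f = B (w f) x / N" for f
    \<comment> \<open>\<open>y\<close> is the component of \<open>x\<close> orthogonal to the vectors \<open>w f\<close>\<close>
    define y where "y = x - (\<Sum>f\<in>UNIV. a f *\<^sub>R w f)"
    have lin: "linear (B z)" for z using B by (simp add: bilinear_def)
    have right: "B z y = B z x - (\<Sum>f\<in>UNIV. a f * B z (w f))" for z
      by (simp add: y_def linear_diff[OF lin] linear_sum[OF lin] linear_scale[OF lin])
    have "B (w g) y = 0" for g
      using N by (simp add: right ortho if_distrib[of "(*) _"] cong: if_cong) (simp add: a_def)
    then have "B y y = B y x"
      unfolding right[of y] by (simp add: sym[of y "w _"])
    also have "\<dots> = B x y" by (rule sym)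
    also have "\<dots> = B x x - (\<Sum>f\<in>UNIV. (B (w f) x)\<^sup>2 / N)"
      unfolding right[of x] by (simp add: sym[of x "w _"] a_def power2_eq_square)
    finally show ?thesis using pos[of y] by (simp add: sq)
  qed
  have eqN: "q_apply \<eta> (coord l 0) \<bullet> q_apply \<eta> (coord l 0) = N"
    unfolding sq w_def[of 0, symmetric] using N
    by (simp add: ortho sum_UNIV_4 power2_eq_square)
  show ?thesis
  proof
    show "\<eta> \<noteq> 0"
      using eqN N by (auto simp: q_apply_def qmult_zero)
    show "B (coord l 0) (coord l 0) = q_apply \<eta> (coord l 0) \<bullet> q_apply \<eta> (coord l 0)"
      by (simp add: eqN N_def)
    have "bilinear (\<lambda>b c. B b c - q_apply \<eta> b \<bullet> q_apply \<eta> c)"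
      using B linear_q_apply[of \<eta>]
      by (auto simp: bilinear_def linear_iff inner_add_left inner_add_right algebra_simps)
    moreover have "B b c - q_apply \<eta> b \<bullet> q_apply \<eta> c = B c b - q_apply \<eta> c \<bullet> q_apply \<eta> b" for b c
      by (simp only: sym[of b c] inner_commute[of "q_apply \<eta> b"])
    moreover have "qmult a (qunit j) \<bullet> qmult b (qunit j) = a \<bullet> b" for a b j
    proof -
      have "\<forall>j. qmult a (qunit j) \<bullet> qmult b (qunit j) = a \<bullet> b"
        by (simp add: all_UNIV_4 inner_quat qmult_nth qunit_nth)
      then show ?thesis by blast
    qed
    ultimately show "q_psd (\<lambda>b c. B b c - q_apply \<eta> b \<bullet> q_apply \<eta> c)"
      unfolding q_psd_def q_apply_right_scale inv using bessel by simp
  qed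
qed

text \<open>
  Subtracting a square as in \<open>q_psd_split_square\<close> creates a zero on the diagonal and, by positivity,
  preserves the existing ones; once the diagonal is zero, so is the form.
\<close>
lemma herm_form_strongly_positive:
  fixes B :: "'n::{finite,linorder} hvec \<Rightarrow> 'n hvec \<Rightarrow> real"
  shows "q_psd B \<Longrightarrow> herm_form B \<in> strongly_positive 1"
proof (induction "card {l. B (coord l 0) (coord l 0) \<noteq> 0}" arbitrary: B rule: less_induct)
  case less
  note q = \<open>q_psd B\<close>
  show ?case
  proof (cases "\<exists>l. B (coord l 0) (coord l 0) \<noteq> 0")
    case False
    moreover have "bilinear B" "\<And>b c. B b c = B c b" "\<And>b. 0 \<le> B b b"
      using q unfolding q_psd_def by blast+
    ultimately have "B (coord l 0) y = 0" for l y
      using psd_null_vector[of B "coord l 0" y] by blast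
    then have "herm_coeff B = (\<lambda>k k'. 0)"
      by (auto simp: herm_coeff_def Let_def complex_eq_iff intro!: ext)
    then have "herm_form B = 0"
      by (simp add: herm_form_def two_form_def)
    then show ?thesis by (simp add: strongly_positive_zero)
  next
    case True
    then obtain l where l: "B (coord l 0) (coord l 0) \<noteq> 0" by blast
    obtain \<eta> where \<eta>: "\<eta> \<noteq> 0" and q': "q_psd (\<lambda>b c. B b c - q_apply \<eta> b \<bullet> q_apply \<eta> c)"
      and zero: "B (coord l 0) (coord l 0) = q_apply \<eta> (coord l 0) \<bullet> q_apply \<eta> (coord l 0)"
      using q_psd_split_square[OF q l] .
    define B' where "B' b c = B b c - q_apply \<eta> b \<bullet> q_apply \<eta> c" for b c
    have mono: "B' (coord m 0) (coord m 0) = 0" if "B (coord m 0) (coord m 0) = 0" for m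
    proof -
      have "0 \<le> B' (coord m 0) (coord m 0)"
        using q' by (simp add: q_psd_def B'_def)
      then show ?thesis
        using that inner_ge_zero[of "q_apply \<eta> (coord m 0)"] unfolding B'_def by linarith
    qed
    have drop: "B' (coord l 0) (coord l 0) = 0"
      unfolding B'_def using zero by linarith
    have "{l. B' (coord l 0) (coord l 0) \<noteq> 0} \<subset> {l. B (coord l 0) (coord l 0) \<noteq> 0}"
      using l drop mono by blast
    then have "herm_form B' \<in> strongly_positive 1"
      using less.hyps[of B'] q' unfolding B'_def[abs_def] by (metis (lifting) finite psubset_card_mono)
    then have "herm_form B' + (pullback \<eta> 0 \<and>\<^sub>e pullback \<eta> 1) \<in> strongly_positive 1"
      by (intro strongly_positive_add_elementary pullback_wedge_elementary \<eta>)
    moreover have "herm_form B = herm_form B' + (pullback \<eta> 0 \<and>\<^sub>e pullback \<eta> 1)"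
      unfolding herm_form_elementary[symmetric] herm_form_add[symmetric] by (simp add: B'_def)
    ultimately show ?thesis by simp
  qed
qed

section \<open>Second derivatives\<close>

lemma partial_eqI: "(f has_derivative f') (at x) \<Longrightarrow> partial v f x = f' v"
  using frechet_derivative_at by metis

lemma has_derivative_partial:
  "f differentiable at x \<Longrightarrow> (f has_derivative (\<lambda>v. partial v f x)) (at x)"
  by (simp add: frechet_derivative_works[symmetric])

lemma linear_partial: "f differentiable at x \<Longrightarrow> linear (\<lambda>v. partial v f x)"
  by (rule linear_frechet_derivative)

lemma has_derivative_at_approx:
  assumes "(g has_derivative D) (at x)" and "0 < e"
  obtains d where "0 < d" "\<And>y. norm (y - x) < d \<Longrightarrow> norm (g y - g x - D (y - x)) \<le> e * norm (y - x)"
  using assms unfolding has_derivative_at_alt by meson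

lemma line_has_real_derivative:
  fixes f :: "'a::real_normed_vector \<Rightarrow> real"
  assumes "f differentiable at (a + s *\<^sub>R c)"
  shows "((\<lambda>s. f (a + s *\<^sub>R c)) has_real_derivative partial c f (a + s *\<^sub>R c)) (at s)"
proof -
  have "((\<lambda>s. a + s *\<^sub>R c) has_derivative (\<lambda>h. h *\<^sub>R c)) (at s)"
    by (auto intro!: derivative_eq_intros)
  from has_derivative_compose[OF this has_derivative_partial[OF assms]]
  have "((\<lambda>s. f (a + s *\<^sub>R c)) has_derivative (\<lambda>h. partial (h *\<^sub>R c) f (a + s *\<^sub>R c))) (at s)" .
  moreover have "partial (h *\<^sub>R c) f (a + s *\<^sub>R c) = partial c f (a + s *\<^sub>R c) * h" for h
    using linear_scale[OF linear_partial[OF assms]] by simp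
  ultimately show ?thesis
    unfolding has_field_derivative_def by simp
qed

text \<open>
  The mean value theorem in the direction \<open>c\<close> turns the second difference into a first difference
  of \<open>\<partial>\<^sub>c f\<close> in the direction \<open>b\<close>, which differentiability of \<open>\<partial>\<^sub>c f\<close> at the single point \<open>x\<close>
  controls.
\<close>
lemma second_difference_limit:
  fixes f :: "'a::real_normed_vector \<Rightarrow> real"
  assumes "open S" "x \<in> S" and f: "\<And>y. y \<in> S \<Longrightarrow> f differentiable at y"
    and g: "partial c f differentiable at x"
  shows "((\<lambda>t. (f (x + t *\<^sub>R b + t *\<^sub>R c) - f (x + t *\<^sub>R b) - f (x + t *\<^sub>R c) + f x) / t\<^sup>2)
           \<longlongrightarrow> partial b (partial c f) x) (at_right 0)"
proof (rule tendstoI)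
  fix e :: real assume e: "0 < e"
  define D where "D v = partial v (partial c f) x" for v
  have linD: "linear D" unfolding D_def using linear_partial[OF g] .
  \<comment> \<open>every point \<open>x + ib + sc\<close> with \<open>i, s\<close> in \<open>[0, t]\<close> has distance at most \<open>t m\<close> from \<open>x\<close>;
    the error \<open>e / (4 m)\<close> is incurred at two such points, so the total error is \<open>e / 2\<close>\<close>
  define m where "m = norm b + norm c + 1"
  have m: "0 < m" by (simp add: m_def add_nonneg_pos)
  obtain d where d: "0 < d" and approx: "\<And>y. norm (y - x) < d \<Longrightarrow>
      norm (partial c f y - partial c f x - D (y - x)) \<le> e / (4 * m) * norm (y - x)"
    using has_derivative_at_approx[OF has_derivative_partial[OF g], of "e / (4 * m)"] e m
    unfolding D_def by auto
  obtain r where r: "0 < r" "ball x r \<subseteq> S" using \<open>open S\<close> \<open>x \<in> S\<close> open_contains_ball by blast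
  have "eventually (\<lambda>t. t < min d r / m) (at_right 0)"
    using d(1) r(1) m by (auto simp: eventually_at_right_field intro!: exI[of _ "min d r / m"])
  moreover have "eventually (\<lambda>t::real. 0 < t) (at_right 0)"
    by (rule eventually_at_right_less)
  ultimately show "eventually (\<lambda>t. dist ((f (x + t *\<^sub>R b + t *\<^sub>R c) - f (x + t *\<^sub>R b) - f (x + t *\<^sub>R c) + f x) / t\<^sup>2)
      (partial b (partial c f) x) < e) (at_right 0)"
  proof eventually_elim
    case (elim t)
    then have t: "0 < t" and tm: "t * m < min d r" using m by (auto simp: field_simps)
    have near: "norm (i *\<^sub>R b + s *\<^sub>R c) \<le> t * m" if "0 \<le> s" "s \<le> t" "0 \<le> i" "i \<le> t" for s i
    proof -
      have "norm (i *\<^sub>R b + s *\<^sub>R c) \<le> i * norm b + s * norm c"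
        using norm_triangle_ineq[of "i *\<^sub>R b" "s *\<^sub>R c"] that by simp
      also have "\<dots> \<le> t * norm b + t * norm c"
        using that by (intro add_mono mult_right_mono) auto
      also have "\<dots> \<le> t * m" using t by (simp add: m_def algebra_simps)
      finally show ?thesis .
    qed
    have inS: "x + (i *\<^sub>R b + s *\<^sub>R c) \<in> S" if "0 \<le> s" "s \<le> t" "0 \<le> i" "i \<le> t" for s i
    proof -
      have "dist x (x + (i *\<^sub>R b + s *\<^sub>R c)) = norm (i *\<^sub>R b + s *\<^sub>R c)"
        by (metis add_diff_cancel_left' dist_commute dist_norm)
      then show ?thesis
        using near[OF that] tm by (intro subsetD[OF r(2)]) simp
    qed
    define h where "h s = f (x + t *\<^sub>R b + s *\<^sub>R c) - f (x + s *\<^sub>R c)" for s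
    have "(h has_real_derivative partial c f (x + t *\<^sub>R b + s *\<^sub>R c) - partial c f (x + s *\<^sub>R c)) (at s)"
      if "0 \<le> s" "s \<le> t" for s
      unfolding h_def using that t inS[of s t] inS[of s 0]
      by (intro DERIV_diff line_has_real_derivative f) (auto simp: add.assoc)
    from MVT2[OF t this] obtain s where s: "0 < s" "s < t"
      and mv: "h t - h 0 = t * (partial c f (x + t *\<^sub>R b + s *\<^sub>R c) - partial c f (x + s *\<^sub>R c))"
      by auto
    have a1: "norm (partial c f (x + t *\<^sub>R b + s *\<^sub>R c) - partial c f x - D (t *\<^sub>R b + s *\<^sub>R c))
        \<le> e / (4 * m) * (t * m)"
    proof -
      have n: "norm (t *\<^sub>R b + s *\<^sub>R c) \<le> t * m" using near[of s t] s t by auto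
      have "norm (x + t *\<^sub>R b + s *\<^sub>R c - x) < d" using n tm by (simp add: add.assoc)
      note approx[OF this]
      also have "x + t *\<^sub>R b + s *\<^sub>R c - x = t *\<^sub>R b + s *\<^sub>R c" by simp
      also have "e / (4 * m) * norm (t *\<^sub>R b + s *\<^sub>R c) \<le> e / (4 * m) * (t * m)"
        using n e m by (intro mult_left_mono) auto
      finally show ?thesis .
    qed
    have a2: "norm (partial c f (x + s *\<^sub>R c) - partial c f x - D (s *\<^sub>R c)) \<le> e / (4 * m) * (t * m)"
    proof -
      have n: "norm (s *\<^sub>R c) \<le> t * m" using near[of s 0] s t by auto
      have "norm (x + s *\<^sub>R c - x) < d" using n tm by (simp add: add.assoc)
      note approx[OF this]
      also have "x + s *\<^sub>R c - x = s *\<^sub>R c" by simp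
      also have "e / (4 * m) * norm (s *\<^sub>R c) \<le> e / (4 * m) * (t * m)"
        using n e m by (intro mult_left_mono) auto
      finally show ?thesis .
    qed
    have eq: "D (t *\<^sub>R b + s *\<^sub>R c) - D (s *\<^sub>R c) = t * D b"
      using linear_add[OF linD] linear_scale[OF linD] by simp
    have em: "e / (4 * m) * (t * m) = e * t / 4" using m by simp
    have "\<bar>(partial c f (x + t *\<^sub>R b + s *\<^sub>R c) - partial c f (x + s *\<^sub>R c)) - t * D b\<bar> \<le> e * t / 2"
      using a1 a2 eq unfolding em real_norm_def by argo
    then have "\<bar>(partial c f (x + t *\<^sub>R b + s *\<^sub>R c) - partial c f (x + s *\<^sub>R c)) / t - D b\<bar> \<le> e / 2"
      using t by (simp add: field_simps abs_if split: if_splits)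
    moreover have "(f (x + t *\<^sub>R b + t *\<^sub>R c) - f (x + t *\<^sub>R b) - f (x + t *\<^sub>R c) + f x) / t\<^sup>2 =
        (partial c f (x + t *\<^sub>R b + s *\<^sub>R c) - partial c f (x + s *\<^sub>R c)) / t"
    proof -
      have "f (x + t *\<^sub>R b + t *\<^sub>R c) - f (x + t *\<^sub>R b) - f (x + t *\<^sub>R c) + f x =
          t * (partial c f (x + t *\<^sub>R b + s *\<^sub>R c) - partial c f (x + s *\<^sub>R c))"
        using mv by (simp add: h_def)
      then show ?thesis using t by (simp add: power2_eq_square)
    qed
    ultimately show ?case
      using e by (simp add: dist_real_def D_def)
  qed
qed

lemma partial_inner:
  fixes f :: "'a::real_normed_vector \<Rightarrow> 'b::real_inner"
  assumes "f differentiable at y"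
  shows "partial b (\<lambda>y. f y \<bullet> z) y = partial b f y \<bullet> z" "(\<lambda>y. f y \<bullet> z) differentiable at y"
proof -
  have d: "((\<lambda>y. f y \<bullet> z) has_derivative (\<lambda>v. partial v f y \<bullet> z)) (at y)"
    by (rule bounded_linear.has_derivative[OF bounded_linear_inner_left has_derivative_partial[OF assms]])
  from partial_eqI[OF this] show "partial b (\<lambda>y. f y \<bullet> z) y = partial b f y \<bullet> z" .
  from d show "(\<lambda>y. f y \<bullet> z) differentiable at y" by (rule differentiableI)
qed

lemma partial_cong_open:
  assumes "open S" "x \<in> S" "\<And>y. y \<in> S \<Longrightarrow> f y = g y"
  shows "partial b f x = partial b g x" "f differentiable at x \<longleftrightarrow> g differentiable at x"
proof -
  have *: "(f has_derivative f') (at x) \<longleftrightarrow> (g has_derivative f') (at x)" for f'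
    using has_derivative_transform_within_open[OF _ assms(1,2), of f f' UNIV g]
      has_derivative_transform_within_open[OF _ assms(1,2), of g f' UNIV f] assms(3) by auto
  then show "f differentiable at x \<longleftrightarrow> g differentiable at x"
    by (simp add: differentiable_def)
  show "partial b f x = partial b g x"
    unfolding frechet_derivative_def * ..
qed

text \<open>
  Young's form of Schwarz's theorem: the second difference is symmetric in \<open>b\<close> and \<open>c\<close>, hence so
  is its limit. Values in an inner product space are treated through their inner products with
  fixed vectors, because the mean value theorem requires real values.
\<close>
lemma partial_commute:
  fixes f :: "'a::real_normed_vector \<Rightarrow> 'b::real_inner"
  assumes "open S" "x \<in> S" and f: "\<And>y. y \<in> S \<Longrightarrow> f differentiable at y"
    and g: "partial b f differentiable at x" "partial c f differentiable at x"
  shows "partial b (partial c f) x = partial c (partial b f) x"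
proof -
  have "partial b (partial c f) x \<bullet> z = partial c (partial b f) x \<bullet> z" for z
  proof -
    let ?f = "\<lambda>y. f y \<bullet> z"
    have eq: "partial v ?f y = partial v f y \<bullet> z" if "y \<in> S" for v y
      using f[OF that] by (rule partial_inner)
    have d: "partial v ?f differentiable at x" if "partial v f differentiable at x" for v
      using partial_inner(2)[OF that, of z] partial_cong_open(2)[OF assms(1,2) eq] by simp
    have pp: "partial w (partial v ?f) x = partial w (partial v f) x \<bullet> z"
      if "partial v f differentiable at x" for v w
      using partial_cong_open(1)[OF assms(1,2) eq] partial_inner(1)[OF that, where b=w and z=z] by simp
    note lim = second_difference_limit[OF assms(1,2) partial_inner(2)[OF f] d]
    have "((\<lambda>t. (?f (x + t *\<^sub>R b + t *\<^sub>R c) - ?f (x + t *\<^sub>R b) - ?f (x + t *\<^sub>R c) + ?f x) / t\<^sup>2)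
           \<longlongrightarrow> partial c (partial b ?f) x) (at_right 0)"
      using lim[OF _ g(1), where b=c] by (simp add: algebra_simps)
    from tendsto_unique[OF trivial_limit_at_right_real lim[OF _ g(2), where b=b] this]
    show ?thesis unfolding pp[OF g(1)] pp[OF g(2)] .
  qed
  then show ?thesis using vector_eq_rdot by blast
qed


lemma Ck_on_2:
  "Ck_on 2 f S \<longleftrightarrow> (\<forall>x\<in>S. f differentiable at x) \<and>
     (\<forall>b\<in>Basis. (\<forall>x\<in>S. partial b f differentiable at x) \<and> (\<forall>c\<in>Basis. continuous_on S (partial c (partial b f))))"
  by (simp add: numeral_2_eq_2)

lemma partial_basis_expansion:
  fixes f :: "'a::euclidean_space \<Rightarrow> 'b::real_normed_vector"
  assumes "f differentiable at x"
  shows "partial v f x = (\<Sum>b\<in>Basis. (v \<bullet> b) *\<^sub>R partial b f x)"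
proof -
  have "partial (\<Sum>b\<in>Basis. (v \<bullet> b) *\<^sub>R b) f x = (\<Sum>b\<in>Basis. (v \<bullet> b) *\<^sub>R partial b f x)"
    by (simp add: linear_sum[OF linear_partial[OF assms]] linear_scale[OF linear_partial[OF assms]])
  then show ?thesis by (simp add: euclidean_representation)
qed

lemma C2_partial_differentiable:
  assumes "Ck_on 2 f S" "open S" "x \<in> S"
  shows "partial v f differentiable at x"
proof -
  have "partial v f y = (\<Sum>b\<in>Basis. (v \<bullet> b) *\<^sub>R partial b f y)" if "y \<in> S" for y
    using assms that by (intro partial_basis_expansion) (auto simp: Ck_on_2)
  moreover have "(\<lambda>y. \<Sum>b\<in>Basis. (v \<bullet> b) *\<^sub>R partial b f y) differentiable at x"
    using assms by (intro differentiable_sum differentiable_scaleR) (auto simp: Ck_on_2)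
  ultimately show ?thesis
    using partial_cong_open(2)[OF assms(2,3), of "partial v f" "\<lambda>y. \<Sum>b\<in>Basis. (v \<bullet> b) *\<^sub>R partial b f y"]
    by blast
qed

lemma C2_bilinear_hessian:
  assumes "Ck_on 2 f S" "open S" "x \<in> S"
  shows "bilinear (\<lambda>v w. partial v (partial w f) x)"
  unfolding bilinear_def
proof (intro conjI allI)
  note d = C2_partial_differentiable[OF assms]
  show "linear (\<lambda>v. partial v (partial w f) x)" for w
    using linear_partial[OF d] .
  have f: "f differentiable at y" if "y \<in> S" for y using assms that by (auto simp: Ck_on_2)
  show "linear (\<lambda>w. partial v (partial w f) x)" for v
  proof (rule linearI)
    fix w w' and r :: real
    have "partial v (partial (w + w') f) x = partial v (\<lambda>y. partial w f y + partial w' f y) x"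
      by (rule partial_cong_open[OF assms(2,3)]) (use linear_partial[OF f] in \<open>auto dest: linear_add\<close>)
    also have "\<dots> = partial v (partial w f) x + partial v (partial w' f) x"
      by (intro partial_eqI has_derivative_add has_derivative_partial d)
    finally show "partial v (partial (w + w') f) x = partial v (partial w f) x + partial v (partial w' f) x" .
    have "partial v (partial (r *\<^sub>R w) f) x = partial v (\<lambda>y. r *\<^sub>R partial w f y) x"
      by (rule partial_cong_open[OF assms(2,3)]) (use linear_partial[OF f] in \<open>auto dest: linear_scale\<close>)
    also have "\<dots> = r *\<^sub>R partial v (partial w f) x"
      by (intro partial_eqI has_derivative_scaleR_right has_derivative_partial d)
    finally show "partial v (partial (r *\<^sub>R w) f) x = r *\<^sub>R partial v (partial w f) x" .
  qed
qed

lemma C2_hessian_sym: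
  fixes f :: "'a::euclidean_space \<Rightarrow> 'b::real_inner"
  assumes "Ck_on 2 f S" "open S" "x \<in> S"
  shows "partial v (partial w f) x = partial w (partial v f) x"
  using assms by (intro partial_commute[OF assms(2,3)] C2_partial_differentiable[OF assms]) (auto simp: Ck_on_2)

text \<open>
  Along the segment from \<open>x\<close> to \<open>x + v\<close> the remainder has derivative
  \<open>\<partial>\<^sub>v f(x + tv) - \<partial>\<^sub>v f(x) - t \<partial>\<^sub>v \<partial>\<^sub>v f(x)\<close>. To bound it uniformly in the direction
  of \<open>v\<close>, it is expanded into the finitely many partial derivatives along the basis, each of which
  is differentiable at \<open>x\<close>.
\<close>
lemma taylor_young_2:
  fixes f :: "'a::euclidean_space \<Rightarrow> real"
  assumes C2: "Ck_on 2 f S" and "open S" "x \<in> S" and e: "0 < e"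
  obtains d where "0 < d" "\<And>v. norm v < d \<Longrightarrow>
    \<bar>f (x + v) - f x - partial v f x - partial v (partial v f) x / 2\<bar> \<le> e * (norm v)\<^sup>2"
proof -
  define n where "n = real DIM('a)"
  have n: "0 < n" by (simp add: n_def)
  have f: "f differentiable at y" if "y \<in> S" for y using C2 that by (auto simp: Ck_on_2)
  note d2 = C2_partial_differentiable[OF C2 assms(2,3)]
  have "\<forall>b. \<exists>d>0. \<forall>y. norm (y - x) < d \<longrightarrow>
      \<bar>partial b f y - partial b f x - partial (y - x) (partial b f) x\<bar> \<le> e / n * norm (y - x)"
  proof
    fix b
    show "\<exists>d>0. \<forall>y. norm (y - x) < d \<longrightarrow>
      \<bar>partial b f y - partial b f x - partial (y - x) (partial b f) x\<bar> \<le> e / n * norm (y - x)"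
    proof -
      obtain d where "0 < d" "\<And>y. norm (y - x) < d \<Longrightarrow>
          norm (partial b f y - partial b f x - partial (y - x) (partial b f) x) \<le> e / n * norm (y - x)"
        using has_derivative_at_approx[OF has_derivative_partial[OF d2[of b]], of "e / n"] e n by auto
      then show ?thesis by (intro exI[of _ d]) (simp only: real_norm_def, blast)
    qed
  qed
  from choice[OF this] obtain \<delta> where \<delta>: "\<And>b. 0 < \<delta> b" "\<And>b y. norm (y - x) < \<delta> b \<Longrightarrow>
      \<bar>partial b f y - partial b f x - partial (y - x) (partial b f) x\<bar> \<le> e / n * norm (y - x)"
    by blast
  obtain r where r: "0 < r" "ball x r \<subseteq> S" using \<open>open S\<close> \<open>x \<in> S\<close> open_contains_ball by blast
  define d where "d = Min (insert r (\<delta> ` Basis))"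
  have d: "0 < d" "d \<le> r" "\<And>b. b \<in> Basis \<Longrightarrow> d \<le> \<delta> b"
    using \<delta>(1) r(1) by (auto simp: d_def simp del: Min_insert intro!: Min_le)
  show thesis
  proof (rule that[OF d(1)])
    fix v :: 'a assume v: "norm v < d"
    have inS: "x + t *\<^sub>R v \<in> S" and tv: "norm (t *\<^sub>R v) \<le> norm v" if "0 \<le> t" "t \<le> 1" for t
    proof -
      show "norm (t *\<^sub>R v) \<le> norm v" using that by (simp add: mult_left_le_one_le)
      then show "x + t *\<^sub>R v \<in> S" using v d(2) r(2) by (auto simp: dist_norm intro!: subsetD[OF r(2)])
    qed
    let ?H = "\<lambda>w. partial w (partial v f) x"
    define R where "R t = f (x + t *\<^sub>R v) - f x - t * partial v f x - t\<^sup>2 * ?H v / 2" for t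
    have "(R has_real_derivative (partial v f (x + t *\<^sub>R v) - partial v f x - t * ?H v)) (at t)"
      if "0 \<le> t" "t \<le> 1" for t
      unfolding R_def using line_has_real_derivative[OF f[OF inS[OF that]]]
      by (auto intro!: derivative_eq_intros)
    from MVT2[OF _ this, of 0 1] obtain t where t: "0 < t" "t < 1"
      and mv: "R 1 - R 0 = partial v f (x + t *\<^sub>R v) - partial v f x - t * ?H v"
      by auto
    let ?D = "\<lambda>b. partial b f (x + t *\<^sub>R v) - partial b f x - partial (t *\<^sub>R v) (partial b f) x"
    have "t * ?H v = ?H (t *\<^sub>R v)"
      using linear_scale[OF linear_partial[OF d2]] by simp
    also have "\<dots> = (\<Sum>b\<in>Basis. (v \<bullet> b) *\<^sub>R partial (t *\<^sub>R v) (partial b f) x)"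
    proof -
      have lin: "linear (\<lambda>w. partial (t *\<^sub>R v) (partial w f) x)"
        using C2_bilinear_hessian[OF C2 assms(2,3)] by (simp add: bilinear_def)
      have "partial (t *\<^sub>R v) (partial (\<Sum>b\<in>Basis. (v \<bullet> b) *\<^sub>R b) f) x =
          (\<Sum>b\<in>Basis. (v \<bullet> b) *\<^sub>R partial (t *\<^sub>R v) (partial b f) x)"
        by (simp add: linear_sum[OF lin] linear_scale[OF lin])
      then show ?thesis by (simp add: euclidean_representation)
    qed
    finally have H: "t * ?H v = (\<Sum>b\<in>Basis. (v \<bullet> b) *\<^sub>R partial (t *\<^sub>R v) (partial b f) x)" .
    have inx: "x + t *\<^sub>R v \<in> S" using inS t by simp
    have "R 1 - R 0 = (\<Sum>b\<in>Basis. (v \<bullet> b) * ?D b)"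
      unfolding mv H partial_basis_expansion[OF f[OF inx], of v] partial_basis_expansion[OF f[OF \<open>x \<in> S\<close>], of v]
      by (simp add: sum_subtractf right_diff_distrib)
    also have "\<bar>\<dots>\<bar> \<le> (\<Sum>b\<in>(Basis::'a set). norm v * (e / n * norm v))"
    proof (rule order_trans[OF sum_abs], rule sum_mono)
      fix b :: 'a assume b: "b \<in> Basis"
      have "\<bar>?D b\<bar> \<le> e / n * norm (t *\<^sub>R v)"
        using \<delta>(2)[of "x + t *\<^sub>R v" b] tv[of t] t v d(3)[OF b] by (simp del: norm_scaleR)
      also have "\<dots> \<le> e / n * norm v"
        using tv[of t] t e n by (intro mult_left_mono) auto
      finally show "\<bar>(v \<bullet> b) * ?D b\<bar> \<le> norm v * (e / n * norm v)"
        unfolding abs_mult using Basis_le_norm[OF b, of v] by (intro mult_mono) auto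
    qed
    also have "\<dots> = e * (norm v)\<^sup>2"
      using n by (simp add: n_def[symmetric] power2_eq_square)
    finally show "\<bar>f (x + v) - f x - partial v f x - partial v (partial v f) x / 2\<bar> \<le> e * (norm v)\<^sup>2"
      by (simp add: R_def)
  qed
qed

section \<open>Subharmonic functions of class C2\<close>

lemma harmonic_quadratic:
  fixes P :: "'a::euclidean_space \<Rightarrow> 'a \<Rightarrow> real"
  assumes P: "bilinear P" and L: "linear L" and trace: "(\<Sum>b\<in>Basis. P b b) = 0"
  shows "harmonic_on S (\<lambda>y. k + L (y - x) + P (y - x) (y - x) / 2)"
proof -
  let ?h = "\<lambda>y. k + L (y - x) + P (y - x) (y - x) / 2"
  have bb: "bounded_bilinear P" using P by (simp add: bilinear_conv_bounded_bilinear)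
  have bl: "bounded_linear L" using L by (simp add: linear_conv_bounded_linear)
  have d1: "(?h has_derivative (\<lambda>v. L v + (P (y - x) v + P v (y - x)) / 2)) (at y)" for y
    by (auto intro!: derivative_eq_intros bounded_linear.has_derivative[OF bl] bounded_bilinear.FDERIV[OF bb])
  have p1: "partial b ?h = (\<lambda>y. L b + (P (y - x) b + P b (y - x)) / 2)" for b
    using partial_eqI[OF d1] by (intro ext)
  have d2: "(partial b ?h has_derivative (\<lambda>v. (P v b + P b v) / 2)) (at y)" for b y
    unfolding p1
    by (auto intro!: derivative_eq_intros bounded_linear.has_derivative[OF bounded_bilinear.bounded_linear_left[OF bb]]
       bounded_linear.has_derivative[OF bounded_bilinear.bounded_linear_right[OF bb]])
  have p2: "partial c (partial b ?h) y = (P c b + P b c) / 2" for b c y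
    using partial_eqI[OF d2] .
  show ?thesis
    unfolding harmonic_on_def Ck_on_2 p2
    using d1 d2 trace by (auto intro: differentiableI)
qed

text \<open>
  The second order Taylor expansion is a hypothesis, so that the lemma applies to compositions
  \<open>\<mu> \<mapsto> u(q + b\<mu>)\<close> without computing their derivatives.
\<close>
lemma subharmonic_laplacian_nonneg:
  fixes g :: "'a::euclidean_space \<Rightarrow> real"
  assumes sub: "subharmonic_on S (\<lambda>y. ereal (g y))" and S: "open S" "x \<in> S"
    and L: "linear L" and Q: "bilinear Q"
    and taylor: "\<And>e. 0 < e \<Longrightarrow> \<exists>d>0. \<forall>v. norm v < d \<longrightarrow>
      \<bar>g (x + v) - g x - L v - Q v v / 2\<bar> \<le> e * (norm v)\<^sup>2"
  shows "0 \<le> (\<Sum>b\<in>Basis. Q b b)"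
proof (rule ccontr)
  define T where "T = (\<Sum>b\<in>Basis. Q b b) / DIM('a)"
  assume "\<not> ?thesis"
  then have T: "T < 0" by (simp add: T_def divide_neg_pos)
  obtain d where d: "0 < d" and dd: "\<And>v. norm v < d \<Longrightarrow>
      \<bar>g (x + v) - g x - L v - Q v v / 2\<bar> \<le> - T / 4 * (norm v)\<^sup>2"
    using taylor[of "- T / 4"] T by auto
  obtain r0 where r0: "0 < r0" "cball x r0 \<subseteq> S" using S open_contains_cball by blast
  define r where "r = min r0 (d / 2)"
  have r: "0 < r" "cball x r \<subseteq> S" "r < d" using d r0 by (auto simp: r_def)
  \<comment> \<open>\<open>P\<close> is the trace-free part of \<open>Q\<close>, so the Taylor polynomial with \<open>P\<close> in place of \<open>Q\<close> is harmonic\<close>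
  define P where "P v w = Q v w - T * (v \<bullet> w)" for v w
  have P: "bilinear P"
    using Q by (auto simp: P_def bilinear_def linear_iff inner_add_left inner_add_right algebra_simps)
  have "(\<Sum>b\<in>Basis. P b b) = 0"
    by (simp add: P_def sum_subtractf T_def)
  \<comment> \<open>on the sphere of radius \<open>r\<close>, replacing \<open>Q\<close> by \<open>P\<close> gains \<open>- T r\<^sup>2 / 2\<close> and the Taylor error costs
    at most half of that, so the constant may be lowered by the other half\<close>
  define h where "h y = g x + T / 4 * r\<^sup>2 + L (y - x) + P (y - x) (y - x) / 2" for y
  have harm: "harmonic_on (interior (cball x r)) h"
    unfolding h_def by (rule harmonic_quadratic) fact+
  have cont: "continuous_on (cball x r) h"
  proof -
    have "harmonic_on UNIV h"
      unfolding h_def by (rule harmonic_quadratic) fact+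
    then have "h differentiable_on UNIV"
      by (simp add: harmonic_on_def Ck_on_2 differentiable_on_def)
    then show ?thesis
      using differentiable_imp_continuous_on continuous_on_subset by blast
  qed
  have bd: "ereal (g y) \<le> ereal (h y)" if "y \<in> frontier (cball x r)" for y
  proof -
    define v where "v = y - x"
    have v: "norm v = r" "y = x + v" using that r by (auto simp: v_def dist_norm norm_minus_commute)
    have "g (x + v) \<le> g x + L v + Q v v / 2 - T / 4 * r\<^sup>2"
      using dd[of v] r v by (simp add: abs_le_iff)
    also have "\<dots> = h y"
      using v by (simp add: h_def P_def power2_norm_eq_inner[symmetric] field_simps)
    finally show ?thesis using v by simp
  qed
  have "\<forall>K h. compact K \<and> K \<subseteq> S \<and> continuous_on K h \<and> harmonic_on (interior K) h \<and>
      (\<forall>y\<in>frontier K. ereal (g y) \<le> ereal (h y)) \<longrightarrow> (\<forall>y\<in>K. ereal (g y) \<le> ereal (h y))"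
    using sub unfolding subharmonic_on_def by (elim conjE)
  from this[rule_format, of "cball x r" h x] have "ereal (g x) \<le> ereal (h x)"
    using r(1,2) harm cont bd by (simp add: less_imp_le)
  moreover have "h x = g x + T / 4 * r\<^sup>2"
    using linear_0[OF L] bilinear_lzero[OF P] by (simp add: h_def)
  ultimately show False
    using T r by (simp add: mult_less_0_iff zero_le_mult_iff)
qed

section \<open>Stability of Ck_on\<close>

lemma Ck_on_cong:
  assumes "open S" "\<And>x. x \<in> S \<Longrightarrow> f x = g x"
  shows "Ck_on k f S \<Longrightarrow> Ck_on k g S"
  using assms(2)
proof (induction k arbitrary: f g)
  case 0
  then show ?case using continuous_on_cong[of S S f g] by simp
next
  case (Suc k)
  have "Ck_on k (partial b g) S" if b: "b \<in> Basis" for b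
    by (rule Suc.IH[of "partial b f"]) (use Suc.prems(1) b partial_cong_open(1)[OF assms(1) _ Suc.prems(2)] in auto)
  then show ?case
    using Suc.prems(1) partial_cong_open(2)[OF assms(1) _ Suc.prems(2)] by auto
qed

lemma Ck_on_bounded_linear:
  assumes T: "bounded_linear T" and "open S"
  shows "Ck_on k f S \<Longrightarrow> Ck_on k (\<lambda>x. T (f x)) S"
proof (induction k arbitrary: f)
  case 0
  then show ?case using bounded_linear.continuous_on[OF T] by simp
next
  case (Suc k)
  have d: "((\<lambda>x. T (f x)) has_derivative (\<lambda>v. T (partial v f x))) (at x)" if "x \<in> S" for x
    using Suc.prems that by (intro bounded_linear.has_derivative[OF T] has_derivative_partial) auto
  have "Ck_on k (partial b (\<lambda>x. T (f x))) S" if b: "b \<in> Basis" for b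
    by (rule Ck_on_cong[OF \<open>open S\<close> _ Suc.IH[of "partial b f"]])
      (use Suc.prems b partial_eqI[OF d] in auto)
  then show ?case using d by (auto intro: differentiableI)
qed

lemma Ck_on_add:
  assumes "open S"
  shows "Ck_on k f S \<Longrightarrow> Ck_on k g S \<Longrightarrow> Ck_on k (\<lambda>x. f x + g x) S"
proof (induction k arbitrary: f g)
  case 0
  then show ?case by (simp add: continuous_on_add)
next
  case (Suc k)
  have d: "((\<lambda>x. f x + g x) has_derivative (\<lambda>v. partial v f x + partial v g x)) (at x)" if "x \<in> S" for x
    using Suc.prems that by (intro has_derivative_add has_derivative_partial) auto
  have "Ck_on k (partial b (\<lambda>x. f x + g x)) S" if b: "b \<in> Basis" for b
    by (rule Ck_on_cong[OF assms _ Suc.IH[of "partial b f" "partial b g"]])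
      (use Suc.prems b partial_eqI[OF d] in auto)
  then show ?case using d by (auto intro: differentiableI)
qed

lemma Ck_on_zero: "Ck_on k (\<lambda>x. 0) S"
  by (induction k) auto

lemma Ck_on_sum:
  assumes "open S" "\<And>i. i \<in> I \<Longrightarrow> Ck_on k (f i) S"
  shows "Ck_on k (\<lambda>x. \<Sum>i\<in>I. f i x) S"
  using assms(2) by (induction I rule: infinite_finite_induct) (auto simp: Ck_on_zero Ck_on_add[OF assms(1)])

lemma Ck_on_imp_continuous_on:
  assumes "Ck_on k f S" shows "continuous_on S f"
proof (cases k)
  case 0
  then show ?thesis using assms by simp
next
  case (Suc m)
  then have "f differentiable_on S"
    using assms by (auto simp: differentiable_on_def differentiable_at_withinI)
  then show ?thesis by (rule differentiable_imp_continuous_on)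
qed

lemma Ck_on_1: "Ck_on 1 f S \<longleftrightarrow> (\<forall>x\<in>S. f differentiable at x) \<and> (\<forall>b\<in>Basis. continuous_on S (partial b f))"
  by (simp add: One_nat_def)

lemma Ck_on_Suc_imp: "Ck_on (Suc k) f S \<Longrightarrow> Ck_on k f S"
proof (induction k arbitrary: f)
  case 0
  then show ?case using Ck_on_imp_continuous_on by fastforce
qed simp

section \<open>The operators nabla\<close>

text \<open>
  The constants that express \<open>nabla\<close> through the four partial derivatives of one quaternionic
  variable; with them, facts about \<open>nabla\<close> follow from linearity without distinguishing cases.
\<close>
definition nabla_coeff :: "2 \<Rightarrow> 2 \<Rightarrow> 4 \<Rightarrow> complex" where
  "nabla_coeff s \<alpha> j =
     (if s = 0 then
        (if \<alpha> = 0 then (if j = 0 then 1 else if j = 1 then \<i> else 0)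
         else (if j = 2 then -1 else if j = 3 then - \<i> else 0))
      else
        (if \<alpha> = 0 then (if j = 2 then 1 else if j = 3 then - \<i> else 0)
         else (if j = 0 then 1 else if j = 1 then - \<i> else 0)))"

lemma nabla_eq: "nabla k \<alpha> f x = (\<Sum>j\<in>UNIV. nabla_coeff (snd k) \<alpha> j * partial (coord (fst k) j) f x)"
  by (auto simp: nabla_def Let_def partial_x_def nabla_coeff_def sum_UNIV_4)

lemma coord_Basis: "coord l j \<in> Basis"
  by (auto simp: Basis_vec_def)

lemma Ck_on_nabla:
  assumes "open S" "Ck_on (Suc k) f S"
  shows "Ck_on k (nabla i \<alpha> f) S"
proof -
  have "Ck_on k (\<lambda>x. \<Sum>j\<in>UNIV. nabla_coeff (snd i) \<alpha> j * partial (coord (fst i) j) f x) S"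
    using assms(2) coord_Basis
    by (intro Ck_on_sum Ck_on_bounded_linear[OF bounded_linear_mult_right] assms(1)) auto
  then show ?thesis unfolding nabla_eq[symmetric] .
qed

lemma nabla_cong_open:
  assumes "open S" "x \<in> S" "\<And>y. y \<in> S \<Longrightarrow> f y = g y"
  shows "nabla k \<alpha> f x = nabla k \<alpha> g x"
  unfolding nabla_eq using partial_cong_open(1)[OF assms] by simp

lemma nabla_zero: "nabla k \<alpha> (\<lambda>x. 0) x = 0"
  by (simp add: nabla_eq)

lemma nabla_sum_mult:
  assumes "\<And>i. i \<in> I \<Longrightarrow> f i differentiable at x"
  shows "nabla k \<alpha> (\<lambda>x. \<Sum>i\<in>I. f i x * a i) x = (\<Sum>i\<in>I. nabla k \<alpha> (f i) x * a i)"
proof -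
  have "((\<lambda>x. \<Sum>i\<in>I. f i x * a i) has_derivative (\<lambda>v. \<Sum>i\<in>I. partial v (f i) x * a i)) (at x)"
    using assms by (intro has_derivative_sum has_derivative_mult_left has_derivative_partial) auto
  from partial_eqI[OF this] show ?thesis
    unfolding nabla_eq by (simp add: sum_distrib_left sum_distrib_right sum.swap[of _ I] mult.assoc)
qed

lemma nabla_nabla:
  assumes "Ck_on 2 f S" "open S" "x \<in> S"
  shows "nabla k \<alpha> (nabla k' \<beta> f) x =
    (\<Sum>i\<in>UNIV. \<Sum>j\<in>UNIV. nabla_coeff (snd k) \<alpha> i * nabla_coeff (snd k') \<beta> j *
       partial (coord (fst k) i) (partial (coord (fst k') j) f) x)"
proof -
  have "nabla k' \<beta> f = (\<lambda>x. \<Sum>j\<in>UNIV. partial (coord (fst k') j) f x * nabla_coeff (snd k') \<beta> j)"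
    by (intro ext) (simp add: nabla_eq mult.commute)
  then have "nabla k \<alpha> (nabla k' \<beta> f) x =
      nabla k \<alpha> (\<lambda>x. \<Sum>j\<in>UNIV. partial (coord (fst k') j) f x * nabla_coeff (snd k') \<beta> j) x"
    by simp
  also have "\<dots> = (\<Sum>j\<in>UNIV. nabla k \<alpha> (partial (coord (fst k') j) f) x * nabla_coeff (snd k') \<beta> j)"
    by (rule nabla_sum_mult) (rule C2_partial_differentiable[OF assms])
  also have "\<dots> = (\<Sum>j\<in>UNIV. \<Sum>i\<in>UNIV. nabla_coeff (snd k) \<alpha> i * nabla_coeff (snd k') \<beta> j *
       partial (coord (fst k) i) (partial (coord (fst k') j) f) x)"
    by (simp add: nabla_eq sum_distrib_left sum_distrib_right mult_ac)
  also have "\<dots> = (\<Sum>i\<in>UNIV. \<Sum>j\<in>UNIV. nabla_coeff (snd k) \<alpha> i * nabla_coeff (snd k') \<beta> j *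
       partial (coord (fst k) i) (partial (coord (fst k') j) f) x)"
    by (rule sum.swap)
  finally show ?thesis .
qed

lemma nabla_commute:
  assumes "Ck_on 2 f S" "open S" "x \<in> S"
  shows "nabla k \<alpha> (nabla k' \<beta> f) x = nabla k' \<beta> (nabla k \<alpha> f) x"
  unfolding nabla_nabla[OF assms]
  by (subst sum.swap) (simp add: C2_hessian_sym[OF assms, of "coord (fst k) _"] mult_ac)

section \<open>Integration by parts\<close>

lemma integral_translate:
  fixes f :: "'a::euclidean_space \<Rightarrow> 'b::{banach, second_countable_topology}"
  assumes "f \<in> borel_measurable borel"
  shows "(\<integral>x. f (c + x) \<partial>lborel) = integral\<^sup>L lborel f"
    and "integrable lborel f \<Longrightarrow> integrable lborel (\<lambda>x. f (c + x))"
proof -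
  have "integral\<^sup>L (distr lborel borel ((+) c)) f = (\<integral>x. f (c + x) \<partial>lborel)"
    by (rule integral_distr) (use assms in auto)
  then show "(\<integral>x. f (c + x) \<partial>lborel) = integral\<^sup>L lborel f"
    by (simp add: lborel_distr_plus)
  have "integrable (distr lborel borel ((+) c)) f \<longleftrightarrow> integrable lborel (\<lambda>x. f (c + x))"
    by (rule integrable_distr_eq) (use assms in auto)
  then show "integrable lborel f \<Longrightarrow> integrable lborel (\<lambda>x. f (c + x))"
    by (simp add: lborel_distr_plus)
qed

lemma integrable_compact_support:
  fixes f :: "'a::euclidean_space \<Rightarrow> 'b::{banach, second_countable_topology}"
  assumes "compact K" "continuous_on K f" "\<And>x. x \<notin> K \<Longrightarrow> f x = 0"
  shows "integrable lborel f"
proof -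
  have "(\<lambda>x. indicator K x *\<^sub>R f x) = f"
    using assms(3) by (auto simp: indicator_def)
  then show ?thesis using borel_integrable_compact[OF assms(1,2)] by simp
qed

lemma partial_outside_support:
  assumes "closed K" "\<And>x. x \<notin> K \<Longrightarrow> f x = 0" "x \<notin> K"
  shows "partial v f x = 0"
proof -
  have "partial v f x = partial v (\<lambda>x. 0) x"
    by (rule partial_cong_open(1)[of "- K"]) (use assms in auto)
  then show ?thesis by simp
qed

text \<open>
  The integral of \<open>f\<close> is invariant under translation, so all difference quotients of \<open>f\<close> in the
  direction \<open>v\<close> have integral zero; they converge to the partial derivative and are dominated by a
  constant on a compact set.
\<close>
lemma integral_partial_zero:
  fixes f :: "'a::euclidean_space \<Rightarrow> 'b::{banach, second_countable_topology}"
  assumes f: "\<And>x. f differentiable at x" and cont: "continuous_on UNIV (partial v f)"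
    and K: "compact K" and supp: "\<And>x. x \<notin> K \<Longrightarrow> f x = 0"
  shows "integral\<^sup>L lborel (partial v f) = 0"
proof -
  have contf: "continuous_on UNIV f"
    using f by (auto intro!: differentiable_imp_continuous_on simp: differentiable_on_def)
  have meas: "f \<in> borel_measurable borel" "partial v f \<in> borel_measurable borel"
    using contf cont by (auto intro: borel_measurable_continuous_onI)
  have intf: "integrable lborel f"
    by (rule integrable_compact_support[OF K continuous_on_subset[OF contf subset_UNIV] supp])
  have "compact (partial v f ` K)"
    by (rule compact_continuous_image[OF continuous_on_subset[OF cont subset_UNIV] K])
  then obtain C where C: "0 < C" "\<And>x. x \<in> K \<Longrightarrow> norm (partial v f x) \<le> C"
    using compact_imp_bounded bounded_pos[of "partial v f ` K"] by auto
  have bound: "norm (partial v f x) \<le> C" for x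
    using C partial_outside_support[of K f x v] supp compact_imp_closed[OF K] by (cases "x \<in> K") auto
  \<comment> \<open>\<open>K'\<close> contains the supports of all functions \<open>x \<mapsto> f (x + s v)\<close> with \<open>s\<close> in \<open>[0, 1]\<close>\<close>
  define K' where "K' = (\<lambda>(x, s). x - s *\<^sub>R v) ` (K \<times> {0..1})"
  have K': "compact K'"
    unfolding K'_def
    by (intro compact_continuous_image compact_Times K compact_Icc)
      (auto intro!: continuous_intros simp: case_prod_unfold)
  define t :: "nat \<Rightarrow> real" where "t n = 1 / real (Suc n)" for n
  have t: "0 < t n" "t n \<le> 1" for n by (auto simp: t_def)
  define s where "s n x = (f (t n *\<^sub>R v + x) - f x) /\<^sub>R t n" for n x
  have line: "((\<lambda>r. f (r *\<^sub>R v + x)) has_derivative (\<lambda>h. h *\<^sub>R partial v f (r *\<^sub>R v + x))) (at r)" for r x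
  proof -
    have "((\<lambda>r. r *\<^sub>R v + x) has_derivative (\<lambda>h. h *\<^sub>R v)) (at r)"
      by (auto intro!: derivative_eq_intros)
    from has_derivative_compose[OF this has_derivative_partial[OF f]]
    show ?thesis by (simp add: linear_scale[OF linear_partial[OF f]])
  qed
  have sK: "norm (s n x) \<le> C * indicator K' x" for n x
  proof (cases "x \<in> K'")
    case True
    have "norm (f (t n *\<^sub>R v + x) - f (0 *\<^sub>R v + x)) \<le> C * norm (t n - 0)"
    proof (rule differentiable_bound[of UNIV "\<lambda>r. f (r *\<^sub>R v + x)" "\<lambda>r h. h *\<^sub>R partial v f (r *\<^sub>R v + x)"])
      show "onorm (\<lambda>h. h *\<^sub>R partial v f (r *\<^sub>R v + x)) \<le> C" for r
        using bound C(1) by (intro onorm_bound) (auto simp: mult.commute[of C] intro!: mult_left_mono)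
    qed (auto intro: line)
    moreover have "norm (s n x) = norm (f (t n *\<^sub>R v + x) - f x) / t n"
      using t(1)[of n] by (simp add: s_def divide_inverse_commute)
    ultimately show ?thesis using True t(1)[of n] by (simp add: pos_divide_le_eq)
  next
    case False
    have *: "x + r *\<^sub>R v \<notin> K" if "0 \<le> r" "r \<le> 1" for r
    proof
      assume "x + r *\<^sub>R v \<in> K"
      then have "(\<lambda>(x, s). x - s *\<^sub>R v) (x + r *\<^sub>R v, r) \<in> K'"
        unfolding K'_def using that by (intro imageI) auto
      then show False using False by simp
    qed
    from *[of 0] *[of "t n"] t[of n] have "f (t n *\<^sub>R v + x) = 0" "f x = 0"
      by (auto intro!: supp simp: add.commute)
    then show ?thesis using False by (simp add: s_def)
  qed
  have "(\<lambda>n. integral\<^sup>L lborel (s n)) \<longlonglongrightarrow> integral\<^sup>L lborel (partial v f)"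
  proof (rule integral_dominated_convergence[where w = "\<lambda>x. C * indicator K' x"])
    show "integrable lborel (\<lambda>x. C * indicator K' x)"
      using borel_integrable_compact[OF K', of "\<lambda>x. C"] by (simp add: mult.commute)
    show "AE x in lborel. (\<lambda>n. s n x) \<longlonglongrightarrow> partial v f x"
    proof (rule AE_I2)
      fix x
      have "((\<lambda>r. f (r *\<^sub>R v + x)) has_vector_derivative partial v f x) (at 0)"
        using line[of x 0] by (simp add: has_vector_derivative_def)
      then have "((\<lambda>r. norm (f (r *\<^sub>R v + x) - f x - r *\<^sub>R partial v f x) / norm r) \<longlongrightarrow> 0) (at 0)"
        unfolding has_vector_derivative_def has_derivative_at by simp
      moreover have "norm (f (r *\<^sub>R v + x) - f x - r *\<^sub>R partial v f x) / norm r =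
          norm ((f (r *\<^sub>R v + x) - f x) /\<^sub>R r - partial v f x)" if "r \<noteq> 0" for r
      proof -
        have "(f (r *\<^sub>R v + x) - f x) /\<^sub>R r - partial v f x =
            (f (r *\<^sub>R v + x) - f x - r *\<^sub>R partial v f x) /\<^sub>R r"
          using that by (simp add: scaleR_right_diff_distrib)
        then show ?thesis by (simp add: divide_inverse_commute)
      qed
      then have "eventually (\<lambda>r. norm (f (r *\<^sub>R v + x) - f x - r *\<^sub>R partial v f x) / norm r =
          norm ((f (r *\<^sub>R v + x) - f x) /\<^sub>R r - partial v f x)) (at 0)"
        by (auto simp: eventually_at_filter)
      ultimately have "((\<lambda>r. norm ((f (r *\<^sub>R v + x) - f x) /\<^sub>R r - partial v f x)) \<longlongrightarrow> 0) (at 0)"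
        by (rule Lim_transform_eventually)
      then have "((\<lambda>r. (f (r *\<^sub>R v + x) - f x) /\<^sub>R r) \<longlongrightarrow> partial v f x) (at 0)"
        by (rule LIM_zero_cancel[OF tendsto_norm_zero_cancel])
      moreover have "t \<longlonglongrightarrow> 0"
        using LIMSEQ_inverse_real_of_nat by (simp add: t_def[abs_def] inverse_eq_divide)
      then have "filterlim t (at 0) sequentially"
        unfolding filterlim_at using t(1) by (simp add: less_imp_neq[THEN not_sym])
      ultimately show "(\<lambda>n. s n x) \<longlonglongrightarrow> partial v f x"
        unfolding s_def by (rule filterlim_compose)
    qed
    show "s n \<in> borel_measurable lborel" for n
      unfolding s_def using meas(1) by measurable
    show "AE x in lborel. norm (s n x) \<le> C * indicator K' x" for n
      using sK by simp
  qed (use meas in simp)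
  moreover have "integral\<^sup>L lborel (s n) = 0" for n
    unfolding s_def using intf integral_translate[OF meas(1), of "t n *\<^sub>R v"] by simp
  ultimately show ?thesis
    by (simp add: LIMSEQ_const_iff)
qed

lemma set_integrable_compact_support:
  fixes h :: "'a::euclidean_space \<Rightarrow> 'b::{banach, second_countable_topology}"
  assumes "compact K" "K \<subseteq> S" "continuous_on S h" "\<And>x. x \<in> S \<Longrightarrow> x \<notin> K \<Longrightarrow> h x = 0"
  shows "set_integrable lborel S h"
proof -
  have "(\<lambda>x. indicator S x *\<^sub>R h x) = (\<lambda>x. indicator K x *\<^sub>R h x)"
    using assms(2,4) by (auto simp: fun_eq_iff split: split_indicator)
  then show ?thesis
    unfolding set_integrable_def
    using borel_integrable_compact[OF assms(1) continuous_on_subset[OF assms(3,2)]] by simp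
qed

lemma nabla_mult:
  assumes "f differentiable at x" "g differentiable at x"
  shows "nabla k \<alpha> (\<lambda>x. f x * g x) x = nabla k \<alpha> f x * g x + f x * nabla k \<alpha> g x"
proof -
  have "((\<lambda>x. f x * g x) has_derivative (\<lambda>v. f x * partial v g x + partial v f x * g x)) (at x)"
    by (rule has_derivative_mult[OF assms[THEN has_derivative_partial]])
  from partial_eqI[OF this] show ?thesis
    by (simp add: nabla_eq sum_distrib_left sum_distrib_right sum.distrib algebra_simps)
qed

lemma test_function_nabla:
  assumes "test_function \<Omega> \<phi>"
  shows "test_function \<Omega> (nabla k \<alpha> \<phi>)"
proof -
  let ?K = "closure {x. \<phi> x \<noteq> 0}"
  have zero: "nabla k \<alpha> \<phi> x = 0" if "x \<notin> ?K" for x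
  proof -
    have "\<phi> y = 0" if "y \<notin> ?K" for y
      using that closure_subset[of "{x. \<phi> x \<noteq> 0}"] by blast
    then have "partial v \<phi> x = 0" for v
      by (rule partial_outside_support[OF closed_closure _ that])
    then show ?thesis by (simp add: nabla_eq)
  qed
  have sub: "closure {x. nabla k \<alpha> \<phi> x \<noteq> 0} \<subseteq> ?K"
  proof (rule closure_minimal)
    show "{x. nabla k \<alpha> \<phi> x \<noteq> 0} \<subseteq> ?K" using zero by blast
  qed (rule closed_closure)
  have "compact ?K" using assms by (simp only: test_function_def)
  then have "compact (?K \<inter> closure {x. nabla k \<alpha> \<phi> x \<noteq> 0})"
    by (rule compact_Int_closed) (rule closed_closure)
  then have "compact (closure {x. nabla k \<alpha> \<phi> x \<noteq> 0})"
    by (simp only: inf.absorb2[OF sub])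
  moreover have "Ck_on m (nabla k \<alpha> \<phi>) UNIV" for m
    by (rule Ck_on_nabla[OF open_UNIV]) (use assms in \<open>simp only: test_function_def\<close>)
  moreover have "closure {x. nabla k \<alpha> \<phi> x \<noteq> 0} \<subseteq> \<Omega>"
    by (rule order_trans[OF sub]) (use assms in \<open>simp only: test_function_def\<close>)
  ultimately show ?thesis unfolding test_function_def by blast
qed

text \<open>
  The product \<open>f\<phi>\<close>, extended by zero outside \<open>\<Omega>\<close>, is continuously differentiable on the whole
  space because \<open>\<phi>\<close> vanishes near the boundary of \<open>\<Omega>\<close>. Hence the integral of its derivatives is
  zero.
\<close>
lemma nabla_by_parts:
  assumes \<Omega>: "open \<Omega>" and f: "Ck_on 1 f \<Omega>" and \<phi>: "test_function \<Omega> \<phi>"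
  shows "set_lebesgue_integral lborel \<Omega> (\<lambda>x. nabla k \<alpha> f x * \<phi> x) =
    - set_lebesgue_integral lborel \<Omega> (\<lambda>x. f x * nabla k \<alpha> \<phi> x)"
proof -
  define K where "K = closure {x. \<phi> x \<noteq> 0}"
  have K: "compact K" "closed K" "K \<subseteq> \<Omega>" using \<phi> by (auto simp: test_function_def K_def)
  have \<phi>0: "\<phi> x = 0" if "x \<notin> K" for x
    using that closure_subset[of "{x. \<phi> x \<noteq> 0}"] by (auto simp: K_def)
  have \<phi>0': "nabla k \<alpha> \<phi> x = 0" if "x \<notin> K" for x
    using partial_outside_support[OF K(2) \<phi>0 that] by (simp add: nabla_eq)
  have \<phi>1: "Ck_on 1 \<phi> UNIV" using \<phi> by (auto simp: test_function_def)
  have df: "f differentiable at x" if "x \<in> \<Omega>" for x using f that by (simp add: Ck_on_1)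
  have d\<phi>: "\<phi> differentiable at x" for x using \<phi>1 by (simp add: Ck_on_1)
  have cf: "continuous_on \<Omega> f" "continuous_on \<Omega> (nabla k \<alpha> f)"
    using Ck_on_imp_continuous_on[OF f] Ck_on_nabla[OF \<Omega>, of 0 f k \<alpha>] f by simp_all
  have c\<phi>: "continuous_on \<Omega> \<phi>" "continuous_on \<Omega> (nabla k \<alpha> \<phi>)"
    using Ck_on_imp_continuous_on[OF \<phi>1] Ck_on_nabla[OF open_UNIV, of 0 \<phi> k \<alpha>] \<phi>1
    by (auto intro: continuous_on_subset)
  have i1: "set_integrable lborel \<Omega> (\<lambda>x. nabla k \<alpha> f x * \<phi> x)"
    and i2: "set_integrable lborel \<Omega> (\<lambda>x. f x * nabla k \<alpha> \<phi> x)"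
    by (rule set_integrable_compact_support[OF K(1,3)]; use \<phi>0 \<phi>0' cf c\<phi> in \<open>auto intro: continuous_on_mult\<close>)+
  define g where "g x = (if x \<in> \<Omega> then f x * \<phi> x else 0)" for x
  have g0: "g x = 0" if "x \<notin> K" for x using \<phi>0[OF that] by (simp add: g_def)
  have gd: "(g has_derivative (\<lambda>v. f x * partial v \<phi> x + partial v f x * \<phi> x)) (at x)" if "x \<in> \<Omega>" for x
    by (rule has_derivative_transform_within_open[OF has_derivative_mult[OF df[OF that, THEN has_derivative_partial]
        d\<phi>[THEN has_derivative_partial]] \<Omega> that]) (simp add: g_def)
  have dg: "g differentiable at x" for x
  proof (cases "x \<in> \<Omega>")
    case True
    then show ?thesis using gd differentiableI by blast
  next
    case False
    then have "x \<in> - K" using K by blast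
    then show ?thesis
      using partial_cong_open(2)[of "- K" x g "\<lambda>_. 0"] K(2) g0 by auto
  qed
  have cg: "continuous_on UNIV (partial b g)" if "b \<in> Basis" for b
  proof -
    have "continuous_on \<Omega> (\<lambda>x. f x * partial b \<phi> x + partial b f x * \<phi> x)"
      using cf c\<phi> f \<phi>1 that unfolding Ck_on_1
      by (intro continuous_intros) (auto intro: continuous_on_subset)
    then have "continuous_on \<Omega> (partial b g)"
      by (rule continuous_on_cong[OF refl, THEN iffD1, rotated]) (simp add: partial_eqI[OF gd])
    moreover have "continuous_on (- K) (partial b g)"
      by (rule continuous_on_cong[OF refl, THEN iffD1, OF _ continuous_on_const[of "- K" 0]])
        (use partial_outside_support[OF K(2) g0] in auto)
    ultimately have "continuous_on (\<Omega> \<union> - K) (partial b g)"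
      using \<Omega> K(2) by (intro continuous_on_open_Un) auto
    moreover have "\<Omega> \<union> - K = UNIV" using K(3) by blast
    ultimately show ?thesis by simp
  qed
  have ig: "integrable lborel (partial b g)" if "b \<in> Basis" for b
    by (rule integrable_compact_support[OF K(1) continuous_on_subset[OF cg[OF that] subset_UNIV]])
      (rule partial_outside_support[OF K(2) g0])
  have "integral\<^sup>L lborel (nabla k \<alpha> g) =
      (\<Sum>j\<in>UNIV. nabla_coeff (snd k) \<alpha> j * integral\<^sup>L lborel (partial (coord (fst k) j) g))"
    unfolding nabla_eq using ig[OF coord_Basis] by (subst Bochner_Integration.integral_sum) auto
  also have "\<dots> = 0"
    using integral_partial_zero[OF dg cg[OF coord_Basis] K(1) g0] by simp
  finally have int0: "integral\<^sup>L lborel (nabla k \<alpha> g) = 0" .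
  have pw: "nabla k \<alpha> g x =
      indicator \<Omega> x *\<^sub>R (nabla k \<alpha> f x * \<phi> x) + indicator \<Omega> x *\<^sub>R (f x * nabla k \<alpha> \<phi> x)" for x
  proof (cases "x \<in> \<Omega>")
    case True
    have "nabla k \<alpha> g x = nabla k \<alpha> (\<lambda>x. f x * \<phi> x) x"
      by (rule nabla_cong_open[OF \<Omega> True]) (simp add: g_def)
    then show ?thesis using nabla_mult[OF df[OF True] d\<phi>] True by simp
  next
    case False
    then have "partial v g x = 0" for v
      using K(3) by (intro partial_outside_support[OF K(2) g0]) auto
    then show ?thesis using False by (simp add: nabla_eq)
  qed
  have "(\<integral>x. indicator \<Omega> x *\<^sub>R (nabla k \<alpha> f x * \<phi> x) + indicator \<Omega> x *\<^sub>R (f x * nabla k \<alpha> \<phi> x) \<partial>lborel) = 0"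
    using int0 unfolding pw .
  then show ?thesis
    using i1 i2 unfolding set_integrable_def set_lebesgue_integral_def
    by (simp add: eq_neg_iff_add_eq_0)
qed

section \<open>The form of second derivatives\<close>

lemma d_op_zero_form:
  fixes u :: "'n::{finite,linorder} hvec \<Rightarrow> real"
  shows "d_op \<alpha> (zero_form u) q = (\<Sum>k\<in>UNIV. nabla k \<alpha> (\<lambda>x. complex_of_real (u x)) q *s omega k)"
proof -
  have coeff: "(\<lambda>x. zero_form u x $ I) = (if I = {} then (\<lambda>x. complex_of_real (u x)) else (\<lambda>x. 0))" for I
    by (auto simp: zero_form_def omega_set_def axis_def)
  have "(\<Sum>I\<in>UNIV. nabla k \<alpha> (\<lambda>x. zero_form u x $ I) q *s (omega k \<and>\<^sub>e omega_set I)) =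
      (\<Sum>I::'n idx set\<in>UNIV. if I = {} then nabla k \<alpha> (\<lambda>x. complex_of_real (u x)) q *s omega k else 0)" for k
    by (intro sum.cong refl) (auto simp: coeff nabla_zero wedge_unit_right)
  then show ?thesis by (simp add: d_op_def)
qed

lemma laplace_op_eq_two_form:
  assumes "open \<Omega>" "Ck_on 2 u \<Omega>" "q \<in> \<Omega>"
  shows "laplace_op (zero_form u) q =
    two_form (\<lambda>k k'. nabla k 0 (nabla k' 1 (\<lambda>x. complex_of_real (u x))) q)"
proof -
  let ?U = "\<lambda>x. complex_of_real (u x)"
  have "Ck_on 2 ?U \<Omega>"
    by (rule Ck_on_bounded_linear[OF bounded_linear_of_real assms(1,2)])
  then have d: "nabla k' 1 ?U differentiable at q" for k'
    using Ck_on_nabla[OF assms(1), of 1 ?U k' 1] assms(3) by (simp add: Ck_on_1 numeral_2_eq_2)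
  have "(\<Sum>I\<in>UNIV. nabla k 0 (\<lambda>x. d_op 1 (zero_form u) x $ I) q *s (omega k \<and>\<^sub>e omega_set I)) =
      (\<Sum>k'\<in>UNIV. nabla k 0 (nabla k' 1 ?U) q *s (omega k \<and>\<^sub>e omega k'))" for k
  proof -
    have "nabla k 0 (\<lambda>x. d_op 1 (zero_form u) x $ I) q =
        (\<Sum>k'\<in>UNIV. nabla k 0 (nabla k' 1 ?U) q * omega k' $ I)" for I
      using nabla_sum_mult[of UNIV "\<lambda>k'. nabla k' 1 ?U" q k 0 "\<lambda>k'. omega k' $ I"] d
      by (simp add: d_op_zero_form)
    then have "(\<Sum>I\<in>UNIV. nabla k 0 (\<lambda>x. d_op 1 (zero_form u) x $ I) q *s (omega k \<and>\<^sub>e omega_set I)) =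
       (\<Sum>I\<in>UNIV. \<Sum>k'\<in>UNIV. nabla k 0 (nabla k' 1 ?U) q *s (omega k \<and>\<^sub>e (omega k' $ I *s omega_set I)))"
      by (simp add: vec.scale_sum_left wedge_scale_right)
    also have "\<dots> = (\<Sum>k'\<in>UNIV. nabla k 0 (nabla k' 1 ?U) q *s (omega k \<and>\<^sub>e (\<Sum>I\<in>UNIV. omega k' $ I *s omega_set I)))"
      by (subst sum.swap) (simp add: vec.scale_sum_right wedge_sum_right)
    finally show ?thesis by (simp add: ext_expand[symmetric])
  qed
  then show ?thesis
    by (simp add: laplace_op_def d_op_def[of 0] two_form_def)
qed

lemma two_form_nth: "two_form c $ I = (\<Sum>k\<in>UNIV. \<Sum>k'\<in>UNIV. c k k' * (omega k \<and>\<^sub>e omega k') $ I)"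
  by (simp add: two_form_def)

section \<open>Closedness\<close>

text \<open>
  Since \<open>\<triangle>u\<close> is merely continuous, \<open>d\<^sub>\<alpha> \<triangle>u\<close> exists only as a distribution. Moving the two
  derivatives of \<open>u\<close> onto \<open>\<phi>\<close> as well leaves integrals of \<open>u\<close> against third derivatives of the
  smooth function \<open>\<phi>\<close>, which may be taken in any order.
\<close>
lemma dist_d_closed_laplace:
  assumes \<Omega>: "open \<Omega>" and u: "Ck_on 2 u \<Omega>"
  shows "dist_d_closed \<Omega> \<alpha> (laplace_op (zero_form u))"
proof -
  let ?U = "\<lambda>x. complex_of_real (u x)"
  let ?F = "laplace_op (zero_form u)"
  define c where "c k k' q = nabla k 0 (nabla k' 1 ?U) q" for k k' :: "'a idx" and q
  have U2: "Ck_on 2 ?U \<Omega>"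
    by (rule Ck_on_bounded_linear[OF bounded_linear_of_real \<Omega> u])
  then have U1: "Ck_on 1 (nabla k' 1 ?U) \<Omega>" for k'
    by (intro Ck_on_nabla \<Omega>) (simp add: numeral_2_eq_2)
  have U0: "Ck_on 1 ?U \<Omega>"
    using U2 Ck_on_Suc_imp[of 1 ?U \<Omega>] by (simp add: numeral_2_eq_2)
  have cc: "continuous_on \<Omega> (c k k')" for k k'
    using Ck_on_nabla[OF \<Omega>, of 0 _ k 0] U1[of k'] by (simp add: c_def[abs_def])
  have F: "?F q $ I = (\<Sum>k\<in>UNIV. \<Sum>k'\<in>UNIV. c k k' q * (omega k \<and>\<^sub>e omega k') $ I)" if "q \<in> \<Omega>" for q I
    using laplace_op_eq_two_form[OF \<Omega> u that] by (simp add: two_form_nth c_def)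
  have cF: "continuous_on \<Omega> (\<lambda>q. ?F q $ I)" for I
    using continuous_on_cong[OF refl F, of \<Omega>] cc by (simp add: continuous_intros)
  have int: "set_integrable lborel K (\<lambda>q. ?F q $ I)" if "compact K" "K \<subseteq> \<Omega>" for K I
    by (rule set_integrable_compact_support[OF that(1) subset_refl]) (use continuous_on_subset[OF cF that(2)] in auto)
  have "dist_d_op \<Omega> \<alpha> ?F \<phi> = 0" if \<phi>: "test_function \<Omega> \<phi>" for \<phi>
  proof -
    \<comment> \<open>two integrations by parts move the derivatives of \<open>u\<close> onto \<open>\<phi>\<close> without a change of sign\<close>
    define T where "T k i j = set_lebesgue_integral lborel \<Omega> (\<lambda>q. ?U q * nabla j 1 (nabla i 0 (nabla k \<alpha> \<phi>)) q)"
      for k i j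
    have tf: "test_function \<Omega> (nabla k \<alpha> \<phi>)" "test_function \<Omega> (nabla i 0 (nabla k \<alpha> \<phi>))" for k i
      using \<phi> by (auto intro: test_function_nabla)
    have parts: "set_lebesgue_integral lborel \<Omega> (\<lambda>q. c i j q * nabla k \<alpha> \<phi> q) = T k i j" for k i j
      unfolding c_def nabla_by_parts[OF \<Omega> U1 tf(1)] nabla_by_parts[OF \<Omega> U0 tf(2)]
      by (simp add: T_def)
    have si: "set_integrable lborel \<Omega> (\<lambda>q. c i j q * nabla k \<alpha> \<phi> q)" for i j k
    proof (rule set_integrable_compact_support)
      show "compact (closure {x. nabla k \<alpha> \<phi> x \<noteq> 0})" "closure {x. nabla k \<alpha> \<phi> x \<noteq> 0} \<subseteq> \<Omega>"
        using tf(1) by (auto simp: test_function_def)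
      have "continuous_on \<Omega> (nabla k \<alpha> \<phi>)"
        using tf(1)[of k] Ck_on_imp_continuous_on continuous_on_subset unfolding test_function_def by blast
      then show "continuous_on \<Omega> (\<lambda>q. c i j q * nabla k \<alpha> \<phi> q)"
        by (intro continuous_on_mult cc)
      show "c i j q * nabla k \<alpha> \<phi> q = 0" if "q \<notin> closure {x. nabla k \<alpha> \<phi> x \<noteq> 0}" for q
        using that closure_subset[of "{x. nabla k \<alpha> \<phi> x \<noteq> 0}"] by auto
    qed
    have dn: "dist_nabla \<Omega> k \<alpha> (\<lambda>q. ?F q $ I) \<phi> = (\<Sum>i\<in>UNIV. \<Sum>j\<in>UNIV. - T k i j * (omega i \<and>\<^sub>e omega j) $ I)"
      for k I
    proof -
      have "set_lebesgue_integral lborel \<Omega> (\<lambda>q. ?F q $ I * nabla k \<alpha> \<phi> q) =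
         set_lebesgue_integral lborel \<Omega> (\<lambda>q. \<Sum>i\<in>UNIV. \<Sum>j\<in>UNIV. (c i j q * nabla k \<alpha> \<phi> q) * (omega i \<and>\<^sub>e omega j) $ I)"
        using \<Omega> by (intro set_lebesgue_integral_cong) (auto simp: F sum_distrib_left sum_distrib_right mult_ac)
      also have "\<dots> = (\<Sum>i\<in>UNIV. \<Sum>j\<in>UNIV. T k i j * (omega i \<and>\<^sub>e omega j) $ I)"
        using si[unfolded set_integrable_def]
        by (simp add: parts[symmetric] set_lebesgue_integral_def scaleR_sum_right
            flip: mult_scaleR_left)
      finally show ?thesis by (simp add: dist_nabla_def sum_negf)
    qed
    define S where "S = (\<Sum>k\<in>UNIV. \<Sum>i\<in>UNIV. \<Sum>j\<in>UNIV. T k i j *s (omega k \<and>\<^sub>e (omega i \<and>\<^sub>e omega j)))"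
    have "(\<Sum>I\<in>UNIV. dist_nabla \<Omega> k \<alpha> (\<lambda>x. ?F x $ I) \<phi> *s (omega k \<and>\<^sub>e omega_set I)) =
        - (\<Sum>i\<in>UNIV. \<Sum>j\<in>UNIV. T k i j *s (omega k \<and>\<^sub>e (omega i \<and>\<^sub>e omega j)))" for k
    proof -
      have "(\<Sum>I\<in>UNIV. dist_nabla \<Omega> k \<alpha> (\<lambda>x. ?F x $ I) \<phi> *s (omega k \<and>\<^sub>e omega_set I)) =
          omega k \<and>\<^sub>e (\<Sum>I\<in>UNIV. two_form (\<lambda>i j. - T k i j) $ I *s omega_set I)"
        unfolding dn two_form_nth[symmetric] by (simp add: wedge_sum_right wedge_scale_right)
      also have "\<dots> = omega k \<and>\<^sub>e two_form (\<lambda>i j. - T k i j)"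
        by (simp only: ext_expand[symmetric])
      finally show ?thesis
        by (simp add: two_form_def wedge_sum_right wedge_scale_right sum_negf wedge_minus_right)
    qed
    then have dS: "dist_d_op \<Omega> \<alpha> ?F \<phi> = - S"
      by (simp add: dist_d_op_def S_def sum_negf)
    have smooth: "Ck_on 2 \<phi> UNIV" "Ck_on 2 (nabla k \<beta> \<phi>) UNIV" for k \<beta>
      using \<phi> test_function_nabla[OF \<phi>, of k \<beta>] by (auto simp: test_function_def)
    have "S = - S"
    proof (cases "\<alpha> = 0")
      case True
      have "T i k j = T k i j" for i j k
      proof -
        have "nabla i 0 (nabla k 0 \<phi>) = nabla k 0 (nabla i 0 \<phi>)"
          by (rule ext) (rule nabla_commute[OF smooth(1) open_UNIV UNIV_I])
        then show ?thesis by (simp add: T_def True)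
      qed
      then have "S = (\<Sum>k\<in>UNIV. \<Sum>i\<in>UNIV. \<Sum>j\<in>UNIV. T i k j *s (omega k \<and>\<^sub>e (omega i \<and>\<^sub>e omega j)))"
        by (simp add: S_def)
      also have "\<dots> = (\<Sum>i\<in>UNIV. \<Sum>k\<in>UNIV. \<Sum>j\<in>UNIV. T i k j *s (omega k \<and>\<^sub>e (omega i \<and>\<^sub>e omega j)))"
        by (rule sum.swap)
      also have "\<dots> = (\<Sum>i\<in>UNIV. \<Sum>k\<in>UNIV. \<Sum>j\<in>UNIV. - (T i k j *s (omega i \<and>\<^sub>e (omega k \<and>\<^sub>e omega j))))"
        by (intro sum.cong refl) (subst omega_anticommute, simp)
      finally show ?thesis by (simp add: S_def sum_negf)
    next
      case False
      then have \<alpha>: "\<alpha> = 1" using index_2_cases by blast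
      have T: "T j i k = T k i j" for i j k
      proof -
        have "nabla i 0 (nabla k 1 \<phi>) = nabla k 1 (nabla i 0 \<phi>)" for i k
          by (rule ext) (rule nabla_commute[OF smooth(1) open_UNIV UNIV_I])
        moreover have "nabla j 1 (nabla k 1 (nabla i 0 \<phi>)) = nabla k 1 (nabla j 1 (nabla i 0 \<phi>))"
          by (rule ext) (rule nabla_commute[OF smooth(2) open_UNIV UNIV_I])
        ultimately show ?thesis by (simp add: T_def \<alpha>)
      qed
      \<comment> \<open>exchanging the two outer factors is an odd permutation\<close>
      have w: "omega j \<and>\<^sub>e (omega i \<and>\<^sub>e omega k) = - (omega k \<and>\<^sub>e (omega i \<and>\<^sub>e omega j))" for i j k
      proof -
        have "omega j \<and>\<^sub>e (omega i \<and>\<^sub>e omega k) = omega i \<and>\<^sub>e (omega k \<and>\<^sub>e omega j)"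
          by (subst omega_anticommute, subst omega_anticommute2) (simp add: wedge_minus_right)
        then show ?thesis by (subst (asm) omega_anticommute)
      qed
      have "S = (\<Sum>k\<in>UNIV. \<Sum>i\<in>UNIV. \<Sum>j\<in>UNIV. T j i k *s (omega k \<and>\<^sub>e (omega i \<and>\<^sub>e omega j)))"
        by (simp add: S_def T)
      also have "\<dots> = (\<Sum>i\<in>UNIV. \<Sum>k\<in>UNIV. \<Sum>j\<in>UNIV. T j i k *s (omega k \<and>\<^sub>e (omega i \<and>\<^sub>e omega j)))"
        by (rule sum.swap)
      also have "\<dots> = (\<Sum>i\<in>UNIV. \<Sum>j\<in>UNIV. \<Sum>k\<in>UNIV. T j i k *s (omega k \<and>\<^sub>e (omega i \<and>\<^sub>e omega j)))"
        by (intro sum.cong refl sum.swap)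
      also have "\<dots> = (\<Sum>j\<in>UNIV. \<Sum>i\<in>UNIV. \<Sum>k\<in>UNIV. T j i k *s (omega k \<and>\<^sub>e (omega i \<and>\<^sub>e omega j)))"
        by (rule sum.swap)
      also have "\<dots> = (\<Sum>j\<in>UNIV. \<Sum>i\<in>UNIV. \<Sum>k\<in>UNIV. - (T j i k *s (omega j \<and>\<^sub>e (omega i \<and>\<^sub>e omega k))))"
        by (intro sum.cong refl) (subst w, simp)
      finally show ?thesis by (simp add: S_def sum_negf)
    qed
    then have "S = 0" by (simp add: vec_eq_iff)
    then show ?thesis by (simp add: dS)
  qed
  then show ?thesis using int by (auto simp: dist_d_closed_def)
qed

section \<open>Strong positivity\<close>

text \<open>
  The antisymmetrised second derivatives contain the Hessian \<open>H\<close> only in the combinations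
  \<open>\<Sum>\<^sub>e H(e\<^sub>l e, e\<^sub>m fe)\<close> with \<open>f\<close> a unit, which are the values of the trace. Symmetry of the Hessian
  is used to bring the derivatives of the two antisymmetrised terms into the same order.
\<close>
lemma laplace_op_eq_herm_form:
  assumes "open \<Omega>" "Ck_on 2 u \<Omega>" "q \<in> \<Omega>"
  shows "laplace_op (zero_form u) q = herm_form (q_trace (\<lambda>v w. partial v (partial w u) q))"
  unfolding laplace_op_eq_two_form[OF assms]
proof (rule two_form_eq_herm_form)
  fix k k' :: "'a idx"
  let ?U = "\<lambda>x. complex_of_real (u x)"
  define H where "H v w = partial v (partial w u) q" for v w
  have U2: "Ck_on 2 ?U \<Omega>"
    by (rule Ck_on_bounded_linear[OF bounded_linear_of_real assms(1,2)])
  have H: "partial v (partial w ?U) q = complex_of_real (H v w)" for v w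
  proof -
    have "partial w ?U x = complex_of_real (partial w u x)" if "x \<in> \<Omega>" for x
      using assms(2) that
      by (intro partial_eqI bounded_linear.has_derivative[OF bounded_linear_of_real] has_derivative_partial)
        (auto simp: Ck_on_2)
    then have "partial v (partial w ?U) q = partial v (\<lambda>x. complex_of_real (partial w u x)) q"
      by (rule partial_cong_open[OF assms(1,3)])
    also have "\<dots> = complex_of_real (H v w)"
      unfolding H_def using C2_partial_differentiable[OF assms(2,1,3)]
      by (intro partial_eqI bounded_linear.has_derivative[OF bounded_linear_of_real] has_derivative_partial)
    finally show ?thesis .
  qed
  have bil: "bilinear H"
    using C2_bilinear_hessian[OF assms(2,1,3)] by (simp add: H_def[abs_def])
  have sym: "H (coord (fst k') i) (coord (fst k) j) = H (coord (fst k) j) (coord (fst k') i)" for i j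
    unfolding H_def by (rule C2_hessian_sym[OF assms(2,1,3)])
  have tr: "q_trace H (coord l 0) (coord m j) = (\<Sum>i\<in>UNIV. H (coord l i) (axis m (qmult (qunit j) (qunit i))))" for l m j
    by (simp add: q_trace_def right_scale_axis qmult_units)
  have "nabla k 0 (nabla k' 1 ?U) q - nabla k' 0 (nabla k 1 ?U) q = herm_coeff (q_trace H) k k'"
    unfolding nabla_nabla[OF U2 assms(1,3)] H
    using index_2_cases[of "snd k"] index_2_cases[of "snd k'"]
    by (elim disjE) (simp_all add: herm_coeff_def Let_def tr sum_UNIV_4 qmult_units axis_minus
      bilinear_minus[OF bil] nabla_coeff_def sym complex_eq_iff)
  then show "nabla k 0 (nabla k' 1 ?U) q - nabla k' 0 (nabla k 1 ?U) q =
     herm_coeff (q_trace (\<lambda>v w. partial v (partial w u) q)) k k'"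
    by (simp add: H_def[abs_def])
qed

text \<open>
  The value is the Laplacian of the subharmonic function \<open>\<mu> \<mapsto> u(q + b\<mu>)\<close> at \<open>0\<close>.
\<close>
lemma psh_q_trace_hessian_nonneg:
  assumes \<Omega>: "open \<Omega>" and psh: "psh_on \<Omega> (\<lambda>q. ereal (u q))" and u: "Ck_on 2 u \<Omega>" and q: "q \<in> \<Omega>"
  shows "0 \<le> q_trace (\<lambda>v w. partial v (partial w u) q) b b"
proof (cases "b = 0")
  case True
  have "right_scale b p = 0" for p
    by (simp add: True right_scale_def hvec_eq_iff qmult_zero)
  then show ?thesis
    using bilinear_lzero[OF C2_bilinear_hessian[OF u \<Omega> q]] by (simp add: q_trace_def)
next
  case False
  let ?r = "right_scale b"
  let ?S = "{\<mu>. q + ?r \<mu> \<in> \<Omega>}"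
  let ?Q = "\<lambda>\<mu> \<nu>. partial (?r \<mu>) (partial (?r \<nu>) u) q"
  have lin: "linear ?r" using bounded_linear_right_scale linear_conv_bounded_linear by blast
  have sub: "subharmonic_on ?S (\<lambda>\<mu>. ereal (u (q + ?r \<mu>)))"
    using psh False by (simp add: psh_on_def)
  have "continuous_on UNIV (\<lambda>\<mu>. q + ?r \<mu>)"
    by (intro continuous_intros linear_continuous_on bounded_linear_right_scale)
  then have S: "open ?S"
    using open_vimage[OF \<Omega>, of "\<lambda>\<mu>. q + ?r \<mu>"] by (simp add: vimage_def)
  have "0 \<le> (\<Sum>e\<in>Basis. ?Q e e)"
  proof (rule subharmonic_laplacian_nonneg[OF sub S, where x = 0 and L = "\<lambda>\<mu>. partial (?r \<mu>) u q" and Q = ?Q])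
    show "0 \<in> ?S" using q linear_0[OF lin] by simp
    show "linear (\<lambda>\<mu>. partial (?r \<mu>) u q)"
      using linear_compose[OF lin linear_partial[of u q]] u q by (simp add: Ck_on_2 o_def)
    show "bilinear ?Q"
      using C2_bilinear_hessian[OF u \<Omega> q] linear_compose[OF lin, unfolded o_def]
      unfolding bilinear_def by blast
    fix e :: real assume e: "0 < e"
    obtain M where M: "0 < M" "\<And>\<mu>. norm (?r \<mu>) \<le> norm \<mu> * M"
      using bounded_linear.pos_bounded[OF bounded_linear_right_scale, of b] by blast
    obtain d where d: "0 < d" and dd: "\<And>v. norm v < d \<Longrightarrow>
        \<bar>u (q + v) - u q - partial v u q - partial v (partial v u) q / 2\<bar> \<le> e / M\<^sup>2 * (norm v)\<^sup>2"
      using taylor_young_2[OF u \<Omega> q, of "e / M\<^sup>2"] e M by auto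
    show "\<exists>d>0. \<forall>\<mu>. norm \<mu> < d \<longrightarrow>
        \<bar>u (q + ?r (0 + \<mu>)) - u (q + ?r 0) - partial (?r \<mu>) u q - ?Q \<mu> \<mu> / 2\<bar> \<le> e * (norm \<mu>)\<^sup>2"
    proof (intro exI[of _ "d / M"] conjI allI impI)
      show "0 < d / M" using d M by simp
      fix \<mu> :: quat assume \<mu>: "norm \<mu> < d / M"
      then have "norm (?r \<mu>) < d"
        using M(2)[of \<mu>] M(1) by (simp add: field_simps)
      note dd[OF this]
      also have "e / M\<^sup>2 * (norm (?r \<mu>))\<^sup>2 \<le> e / M\<^sup>2 * (norm \<mu> * M)\<^sup>2"
        using e M by (intro mult_left_mono power_mono) auto
      also have "\<dots> = e * (norm \<mu>)\<^sup>2"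
        using M(1) by (simp add: power_mult_distrib)
      finally show "\<bar>u (q + ?r (0 + \<mu>)) - u (q + ?r 0) - partial (?r \<mu>) u q - ?Q \<mu> \<mu> / 2\<bar> \<le> e * (norm \<mu>)\<^sup>2"
        using linear_0[OF lin] by simp
    qed
  qed
  also have "(\<Sum>e\<in>Basis. ?Q e e) = q_trace (\<lambda>v w. partial v (partial w u) q) b b"
  proof -
    have basis: "(Basis :: quat set) = range qunit"
      by (auto simp: Basis_vec_def)
    have "inj qunit"
      by (auto simp: inj_def axis_eq_axis)
    then show ?thesis
      unfolding basis q_trace_def by (subst sum.reindex) (auto simp: o_def)
  qed
  finally show ?thesis .
qed

theorem proposition3p2:
  fixes \<Omega> :: "('n::{finite,linorder}) hvec set"
    and u :: "'n hvec \<Rightarrow> real"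
  assumes "open \<Omega>"
    and "psh_on \<Omega> (\<lambda>q. ereal (u q))"
    and "Ck_on 2 u \<Omega>"
  shows "dist_d_closed \<Omega> 0 (laplace_op (zero_form u))
    \<and> dist_d_closed \<Omega> 1 (laplace_op (zero_form u))
    \<and> (\<forall>q\<in>\<Omega>. laplace_op (zero_form u) q \<in> strongly_positive 1)"
proof (intro conjI ballI dist_d_closed_laplace assms)
  fix q assume q: "q \<in> \<Omega>"
  let ?H = "\<lambda>v w. partial v (partial w u) q"
  have "q_psd (q_trace ?H)"
    using C2_bilinear_hessian C2_hessian_sym psh_q_trace_hessian_nonneg assms q by (intro q_psd_q_trace) blast+
  then show "laplace_op (zero_form u) q \<in> strongly_positive 1"
    unfolding laplace_op_eq_herm_form[OF assms(1,3) q] by (rule herm_form_strongly_positive)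
qed

end
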